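(* In the setting of the context, suppose the ideal $I:=aR[x,y]+\theta'(y)R[x,y]$ is principal. Then $\Lambda$ is a coordinate of $R[y_1][y_0,y_2]$, i.e. $R[y_0,y_1,y_2]=R[y_1,\Lambda,L]$ for some $L\in R[y_0,y_1,y_2]$. Hence $R[x,y]^{\phi}$ is isomorphic to $R[x,y]$ as an $R$-algebra.
   Context: $R$ is a UFD of characteristic $p>0$, $R[x,y]$ the polynomial ring, $0\ne a\in R$, $0\ne\theta(y)=\sum_{i\ge1}s_iy^i\in yR[y]$, $f:=ax+\theta(y)$, $0\ne F\in R[f]$, and $\phi\in\operatorname{Aut}_RR[x,y]$ is given by $\phi(y)=y+aF$, $\phi(x)=x+a^{-1}(\theta(y)-\theta(y+aF))$; $R[x,y]^{\phi}:=\{u\mid\phi(u)=u\}$. Let $d:=\gcd(a,\theta'(y))\in R$ (gcd in $R[y]$), $b:=a/d$, $t_i:=s_i/d$ for $p\nmid i$, $\rho(y):=\sum_{p\nmid i}t_iy^i$, $\rho^p(T):=\sum_{p\nmid i}t_i^pT^i$, $\theta^*(y):=\sum_{i\ge1}s_{pi}y^i$, $q:=y^p-(aF)^{p-1}y$, $q_1:=d^{-1}(f-\theta^*(q))$. Fix $\lambda(x,y)\in R[x,y]$ with $\rho'(y)^py=\lambda(y^p,\rho(y))$ (such exists) and $\nu\in R[y_0,y_1]$ with $(dF)^{p-1}=\nu(q,q_1)$ (such exists). Define $\Lambda:=b^py_2+\rho^p(y_0)-y_1^p+b^{p-1}\lambda(y_0,y_1)\nu(y_0,y_1)\in R[y_0,y_1,y_2]$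 (polynomial ring in three variables). *)

theory Defs
  imports "HOL-Computational_Algebra.Polynomial_Factorial"
begin

text \<open>Bivariate polynomials R[x,y] are represented as nested polynomials 'a poly poly:
  the outer indeterminate is the first variable (x, resp. y0), the inner one the second
  (y, resp. y1). Trivariate R[y0,y1,y2] is 'a poly poly poly with y0 outermost, y2 innermost.\<close>

definition C2 :: "'a::comm_ring_1 \<Rightarrow> 'a poly poly" where
  "C2 c = [:[:c:]:]"

definition C3 :: "'a::comm_ring_1 \<Rightarrow> 'a poly poly poly" where
  "C3 c = [:[:[:c:]:]:]"

definition ev2 :: "('a::zero \<Rightarrow> 'b::comm_ring_1) \<Rightarrow> 'a poly poly \<Rightarrow> 'b \<Rightarrow> 'b \<Rightarrow> 'b" where
  "ev2 h P u v = poly (map_poly (\<lambda>c. poly (map_poly h c) v) P) u"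

definition ev3 :: "('a::zero \<Rightarrow> 'b::comm_ring_1) \<Rightarrow> 'a poly poly poly \<Rightarrow> 'b \<Rightarrow> 'b \<Rightarrow> 'b \<Rightarrow> 'b" where
  "ev3 h P u v w = poly (map_poly (\<lambda>c. ev2 h c v w) P) u"

definition ralg_hom :: "('a::comm_ring_1 poly poly \<Rightarrow> 'a poly poly) \<Rightarrow> bool" where
  "ralg_hom \<psi> \<longleftrightarrow> (\<forall>u v. \<psi> (u + v) = \<psi> u + \<psi> v) \<and> (\<forall>u v. \<psi> (u * v) = \<psi> u * \<psi> v)
     \<and> \<psi> 1 = 1 \<and> (\<forall>c. \<psi> (C2 c) = C2 c)"

end

theory Submission
  imports Defs
begin

text \<open>
  Principality of \<open>I\<close> forces \<open>d \<in> I\<close>, that is, \<open>b r + \<rho>' s = 1\<close> in \<open>R[y]\<close>. Modulo a prime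
  dividing \<open>b\<close>, \<open>\<rho>'\<close> is then a unit, so \<open>\<rho>\<close> and \<open>\<rho>\<^sup>p\<close> are linear with unit slope modulo the radical
  of \<open>b\<close>, and a Newton iteration inverts \<open>\<Lambda>\<close>, as a polynomial in \<open>y\<^sub>0\<close>, modulo \<open>b ^ p\<close>. This makes
  \<open>\<Lambda>\<close> a coordinate.

  For the invariants, \<open>\<Lambda>(q, q\<^sub>1, q\<^sub>2) = 0\<close> defines a polynomial \<open>q\<^sub>2\<close>. After inverting \<open>a\<close>, the
  invariant ring is \<open>R[f, q]\<close> by Artin--Schreier theory. Denominators are removed one prime at a
  time: for \<open>\<pi>\<close> dividing \<open>a\<close> but not \<open>b\<close>, \<open>q \<equiv> y ^ p\<close> and \<open>q\<^sub>1 \<equiv> b x + g(y)\<close> are algebraically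
  independent modulo \<open>\<pi>\<close>; for \<open>\<pi>\<close> dividing \<open>b\<close>, \<open>R[q, q\<^sub>1, q\<^sub>2]\<close> is \<open>R[q\<^sub>1, q\<^sub>2]\<close> modulo \<open>\<pi>\<close>, and
  \<open>q\<^sub>1 \<equiv> t\<^sub>1 y\<close>, \<open>q\<^sub>2 \<equiv> x ^ p + \<dots>\<close> are independent. Hence the invariant ring is
  \<open>R[q, q\<^sub>1, q\<^sub>2] = R[q\<^sub>1, L(q, q\<^sub>1, q\<^sub>2)]\<close>.
\<close>

section \<open>Evaluation homomorphisms, subrings and Taylor expansion\<close>

definition is_hom :: "('a::comm_ring_1 \<Rightarrow> 'b::comm_ring_1) \<Rightarrow> bool" where
  "is_hom h \<longleftrightarrow> h 1 = 1 \<and> (\<forall>u v. h (u + v) = h u + h v) \<and> (\<forall>u v. h (u * v) = h u * h v)"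

definition is_subring :: "'a::comm_ring_1 set \<Rightarrow> bool" where
  "is_subring S \<longleftrightarrow> 1 \<in> S \<and> (\<forall>u\<in>S. \<forall>v\<in>S. u - v \<in> S \<and> u * v \<in> S)"

lemma is_hom_add: "is_hom h \<Longrightarrow> h (u + v) = h u + h v"
  and is_hom_mult: "is_hom h \<Longrightarrow> h (u * v) = h u * h v"
  and is_hom_1: "is_hom h \<Longrightarrow> h 1 = 1"
  unfolding is_hom_def by auto

lemma is_hom_0: "is_hom h \<Longrightarrow> h 0 = 0"
  using is_hom_add[of h 0 0] by simp

lemma is_hom_minus: "is_hom h \<Longrightarrow> h (- u) = - h u"
  using is_hom_add[of h "- u" u] by (simp add: is_hom_0[of h] eq_neg_iff_add_eq_0)

lemma is_hom_diff: "is_hom h \<Longrightarrow> h (u - v) = h u - h v"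
  using is_hom_add[of h u "- v"] by (simp add: is_hom_minus[of h])

lemma is_hom_power: "h (u ^ n) = h u ^ n" if "is_hom h"
  by (induction n) (simp_all add: is_hom_1[OF that] is_hom_mult[OF that])

lemmas hom_simps = is_hom_add is_hom_mult is_hom_1 is_hom_0 is_hom_minus is_hom_diff is_hom_power

lemma is_hom_const: "is_hom (\<lambda>c::'a::comm_ring_1. [:c:])"
  by (auto simp: is_hom_def one_pCons)

lemma is_hom_id: "is_hom (\<lambda>c::'a::comm_ring_1. c)"
  by (auto simp: is_hom_def)

lemma is_hom_comp: "is_hom g \<Longrightarrow> is_hom h \<Longrightarrow> is_hom (\<lambda>c. g (h c))"
  by (auto simp: is_hom_def)

lemma is_hom_C2 [simp]: "is_hom C2" and is_hom_C3 [simp]: "is_hom C3"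
  by (auto simp: is_hom_def C2_def C3_def one_pCons)

lemma eval_pCons:
  "is_hom h \<Longrightarrow> poly (map_poly h (pCons c P)) u = h c + u * poly (map_poly h P) u"
  using map_poly_pCons[of h c P] is_hom_0[of h] by simp

lemma eval_const: "is_hom h \<Longrightarrow> poly (map_poly h [:c:]) u = h c"
  by (simp add: eval_pCons)

lemma eval_var: "is_hom h \<Longrightarrow> poly (map_poly h [:0, 1:]) u = u"
  by (simp add: eval_pCons is_hom_0[of h] is_hom_1[of h])

lemma map_poly_hom_add: "is_hom h \<Longrightarrow> map_poly h (P + Q) = map_poly h P + map_poly h Q"
  by (intro poly_eqI) (simp add: coeff_map_poly[of h] hom_simps[of h])

lemma map_poly_hom_smult: "is_hom h \<Longrightarrow> map_poly h (smult c Q) = smult (h c) (map_poly h Q)"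
  by (intro map_poly_smult) (simp_all add: hom_simps[of h])

lemma map_poly_hom_mult: "is_hom h \<Longrightarrow> map_poly h (P * Q) = map_poly h P * map_poly h Q"
  by (induction P)
    (simp_all add: map_poly_pCons[of h] map_poly_hom_add map_poly_hom_smult is_hom_0[of h])

lemma is_hom_map_poly: "is_hom h \<Longrightarrow> is_hom (map_poly h)"
  by (simp add: is_hom_def[of "map_poly h"] map_poly_hom_add map_poly_hom_mult map_poly_1'
      is_hom_1[of h])

lemma is_hom_eval: "is_hom h \<Longrightarrow> is_hom (\<lambda>P. poly (map_poly h P) u)"
  by (frule is_hom_map_poly) (simp add: is_hom_def[of "\<lambda>P. poly (map_poly h P) u"] hom_simps[of "map_poly h"])

lemma is_hom_ev2: "is_hom h \<Longrightarrow> is_hom (\<lambda>P. ev2 h P u v)"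
  unfolding ev2_def by (intro is_hom_eval)

lemma is_hom_ev3: "is_hom h \<Longrightarrow> is_hom (\<lambda>P. ev3 h P u v w)"
  unfolding ev3_def by (intro is_hom_eval is_hom_ev2)

lemma eval_unique:
  \<comment> \<open>The universal property of \<open>R[T]\<close>. It, and its versions in two and
    three variables, reduce identities between evaluations to a check on constants and
    variables.\<close>
  assumes "is_hom g" "is_hom h" "\<And>c. g [:c:] = h c" "g [:0, 1:] = u"
  shows "g P = poly (map_poly h P) u"
proof (induction P)
  case 0
  show ?case using assms by (simp add: is_hom_0[of g])
next
  case (pCons c P)
  have "pCons c P = [:c:] + [:0, 1:] * P" by simp
  then have "g (pCons c P) = h c + u * g P"
    using assms by (simp only: is_hom_add[of g] is_hom_mult[of g])
  with pCons assms show ?case by (simp add: eval_pCons)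
qed

lemma ev2_unique:
  assumes "is_hom g" "is_hom h" "\<And>c. g [:[:c:]:] = h c" "g [:0, 1:] = u" "g [:[:0, 1:]:] = v"
  shows "g P = ev2 h P u v"
  unfolding ev2_def
  by (intro eval_unique[where g = g] eval_unique[where g = "\<lambda>c. g [:c:]"]
      is_hom_comp[where g = g and h = "\<lambda>c. [:c:]"] is_hom_eval[where h = h] is_hom_const assms)

lemma ev3_unique:
  assumes "is_hom g" "is_hom h" "\<And>c. g [:[:[:c:]:]:] = h c" "g [:0, 1:] = u"
    "g [:[:0, 1:]:] = v" "g [:[:[:0, 1:]:]:] = w"
  shows "g P = ev3 h P u v w"
  unfolding ev3_def
  by (intro eval_unique[where g = g] ev2_unique[where g = "\<lambda>c. g [:c:]"]
      is_hom_comp[where g = g and h = "\<lambda>c. [:c:]"] is_hom_ev2[where h = h] is_hom_const assms)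

lemma hom_eval:
  assumes "is_hom g" "is_hom h"
  shows "g (poly (map_poly h P) u) = poly (map_poly (\<lambda>c. g (h c)) P) (g u)"
  by (rule eval_unique[where g = "\<lambda>P. g (poly (map_poly h P) u)"])
    (use assms in \<open>auto intro!: is_hom_comp[of g h] is_hom_comp[of g "\<lambda>P. poly (map_poly h P) u"]
      is_hom_eval[of h] simp: eval_const eval_var\<close>)

lemma ev2_const: "is_hom h \<Longrightarrow> ev2 h [:[:c:]:] u v = h c"
  and ev2_C2: "is_hom h \<Longrightarrow> ev2 h (C2 c) u v = h c"
  and ev2_inner: "is_hom h \<Longrightarrow> ev2 h [:P:] u v = poly (map_poly h P) v"
  and ev2_x: "is_hom h \<Longrightarrow> ev2 h [:0, 1:] u v = u"
  and ev2_y: "is_hom h \<Longrightarrow> ev2 h [:[:0, 1:]:] u v = v"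
  by (simp_all add: ev2_def C2_def eval_const eval_var is_hom_eval)

lemma ev2_pCons:
  "is_hom h \<Longrightarrow> ev2 h (pCons c P) u v = poly (map_poly h c) v + u * ev2 h P u v"
  by (simp add: ev2_def eval_pCons is_hom_eval)

lemma ev3_C3: "is_hom h \<Longrightarrow> ev3 h (C3 c) u v w = h c"
  and ev3_y0: "is_hom h \<Longrightarrow> ev3 h [:0, 1:] u v w = u"
  and ev3_y1: "is_hom h \<Longrightarrow> ev3 h [:[:0, 1:]:] u v w = v"
  and ev3_y2: "is_hom h \<Longrightarrow> ev3 h [:[:[:0, 1:]:]:] u v w = w"
  by (simp_all add: ev3_def ev2_const ev2_x ev2_y C3_def eval_const eval_var is_hom_ev2)

lemma hom_ev2:
  assumes "is_hom g" "is_hom h"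
  shows "g (ev2 h P u v) = ev2 (\<lambda>c. g (h c)) P (g u) (g v)"
  by (rule ev2_unique[where g = "\<lambda>P. g (ev2 h P u v)"])
    (use assms in \<open>auto intro!: is_hom_comp[of g h] is_hom_comp[of g "\<lambda>P. ev2 h P u v"]
      is_hom_ev2[of h] simp: ev2_const ev2_x ev2_y\<close>)

lemma hom_ev3:
  assumes "is_hom g" "is_hom h"
  shows "g (ev3 h P u v w) = ev3 (\<lambda>c. g (h c)) P (g u) (g v) (g w)"
  by (rule ev3_unique[where g = "\<lambda>P. g (ev3 h P u v w)"])
    (use assms in \<open>auto intro!: is_hom_comp[of g h] is_hom_comp[of g "\<lambda>P. ev3 h P u v w"]
      is_hom_ev3[of h] simp: ev3_C3[unfolded C3_def] ev3_y0 ev3_y1 ev3_y2\<close>)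

lemma ev2_C2_id: "ev2 C2 P [:0, 1:] [:[:0, 1:]:] = P"
  by (rule ev2_unique[where g = "\<lambda>P. P", symmetric]) (auto simp: is_hom_id C2_def)

lemma ev3_C3_id: "ev3 C3 P [:0, 1:] [:[:0, 1:]:] [:[:[:0, 1:]:]:] = P"
  by (rule ev3_unique[where g = "\<lambda>P. P", symmetric]) (auto simp: is_hom_id C3_def)

section \<open>Subrings, and first-order expansions inside them\<close>

lemma is_subringD:
  assumes "is_subring S"
  shows "1 \<in> S" "u \<in> S \<Longrightarrow> v \<in> S \<Longrightarrow> u - v \<in> S" "u \<in> S \<Longrightarrow> v \<in> S \<Longrightarrow> u * v \<in> S"
  using assms unfolding is_subring_def by auto

lemma is_subring_0: "is_subring S \<Longrightarrow> 0 \<in> S"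
  by (metis is_subringD(1,2) diff_self)

lemma is_subring_minus: "is_subring S \<Longrightarrow> u \<in> S \<Longrightarrow> - u \<in> S"
  by (metis is_subringD(2) is_subring_0 diff_0)

lemma is_subring_add: "is_subring S \<Longrightarrow> u \<in> S \<Longrightarrow> v \<in> S \<Longrightarrow> u + v \<in> S"
  by (metis is_subringD(2) is_subring_minus diff_minus_eq_add)

lemma is_subring_power: "is_subring S \<Longrightarrow> u \<in> S \<Longrightarrow> u ^ n \<in> S"
  by (induction n) (auto intro: is_subringD)

lemmas subring_intros = is_subringD is_subring_0 is_subring_minus is_subring_add is_subring_power

lemma is_subring_UNIV: "is_subring UNIV"
  by (simp add: is_subring_def)

lemma is_subring_range: "is_hom h \<Longrightarrow> is_subring (range h)"
  unfolding is_subring_def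
  by (auto simp flip: hom_simps[of h])

lemma subring_poly:
  assumes "is_subring S" "\<And>i. coeff P i \<in> S" "u \<in> S"
  shows "poly P u \<in> S"
  using assms(2)
proof (induction P)
  case 0
  show ?case using assms by (auto intro: subring_intros)
next
  case (pCons c P)
  have "c \<in> S" using pCons(3)[of 0] by simp
  moreover have "poly P u \<in> S"
    using pCons(3)[of "Suc _"] by (intro pCons(2)) simp
  ultimately show ?case using assms by (auto intro!: subring_intros)
qed

lemma subring_eval:
  assumes "is_subring S" "is_hom h" "\<And>c. h c \<in> S" "u \<in> S"
  shows "poly (map_poly h P) u \<in> S"
  using assms by (intro subring_poly) (auto simp: coeff_map_poly[of h] is_hom_0[of h])

lemma subring_ev2:
  assumes "is_subring S" "is_hom h" "\<And>c. h c \<in> S" "u \<in> S" "v \<in> S"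
  shows "ev2 h P u v \<in> S"
  unfolding ev2_def using assms by (intro subring_eval is_hom_eval)

lemma subring_ev3:
  assumes "is_subring S" "is_hom h" "\<And>c. h c \<in> S" "u \<in> S" "v \<in> S" "w \<in> S"
  shows "ev3 h P u v w \<in> S"
  unfolding ev3_def using assms by (intro subring_eval is_hom_ev2 subring_ev2)

text \<open>Induction by Horner's scheme. The cofactor is kept inside \<open>S\<close> because
  \<open>S\<close> will be a proper subring: a ring of polynomials free of \<open>x\<close> modulo a
  prime, or a subring still to be shown equal to the whole ring.\<close>

lemma poly_diff_factor:
  assumes "is_subring S" "\<And>i. coeff P i \<in> S" "u \<in> S" "v \<in> S"
  shows "\<exists>w\<in>S. poly P u - poly P v = (u - v) * w"
  using assms(2)
proof (induction P)
  case 0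
  show ?case using assms by (auto intro!: bexI[of _ 0] subring_intros)
next
  case (pCons c P)
  have coeffs: "coeff P i \<in> S" for i
    using pCons(3)[of "Suc i"] by simp
  then obtain w where w: "w \<in> S" "poly P u - poly P v = (u - v) * w"
    using pCons(2) by blast
  have "poly (pCons c P) u - poly (pCons c P) v = (u - v) * poly P u + v * (poly P u - poly P v)"
    by (simp add: algebra_simps)
  also have "\<dots> = (u - v) * (poly P u + v * w)"
    by (simp add: w algebra_simps)
  finally show ?case
    using w assms coeffs by (auto intro!: subring_intros subring_poly)
qed

lemma poly_taylor2:
  assumes "is_subring S" "\<And>i. coeff P i \<in> S" "u \<in> S" "v \<in> S"
  shows "\<exists>w\<in>S. poly P (u + v) = poly P u + v * poly (pderiv P) u + v\<^sup>2 * w"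
  using assms(2)
proof (induction P)
  case 0
  show ?case using assms by (auto intro!: bexI[of _ 0] subring_intros)
next
  case (pCons c P)
  have coeffs: "coeff P i \<in> S" for i
    using pCons(3)[of "Suc i"] by simp
  have dcoeffs: "coeff (pderiv P) i \<in> S" for i
  proof -
    have "of_nat n * coeff P (Suc i) \<in> S" for n
      by (induction n) (use coeffs assms(1) in \<open>auto simp: ring_distribs intro: subring_intros\<close>)
    then show ?thesis unfolding coeff_pderiv .
  qed
  obtain w where w: "w \<in> S" "poly P (u + v) = poly P u + v * poly (pderiv P) u + v\<^sup>2 * w"
    using pCons(2) coeffs by blast
  have "poly (pCons c P) (u + v) = poly (pCons c P) u + v * poly (pderiv (pCons c P)) u
      + v\<^sup>2 * (u * w + poly (pderiv P) u + v * w)"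
    by (simp add: w pderiv_pCons algebra_simps power2_eq_square)
  then show ?case
    using w assms dcoeffs by (blast intro!: subring_intros subring_poly)
qed

lemma pderiv_map_poly_hom:
  fixes h :: "'a::idom \<Rightarrow> 'b::idom"
  assumes "is_hom h"
  shows "pderiv (map_poly h P) = map_poly h (pderiv P)"
proof -
  have "h (of_nat n) = of_nat n" for n
    by (induction n) (use assms in \<open>auto simp: hom_simps[of h]\<close>)
  then show ?thesis
    using assms by (intro poly_eqI) (simp add: coeff_map_poly[of h] coeff_pderiv hom_simps[of h]
        del: of_nat_Suc)
qed

lemma eval_diff_factor:
  assumes "is_subring S" "is_hom h" "\<And>c. h c \<in> S" "u \<in> S" "v \<in> S"
  shows "\<exists>w\<in>S. poly (map_poly h P) u - poly (map_poly h P) v = (u - v) * w"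
  using assms by (intro poly_diff_factor) (auto simp: coeff_map_poly[of h] is_hom_0[of h])

lemma eval_taylor2:
  fixes h :: "'a::idom \<Rightarrow> 'b::idom"
  assumes "is_subring S" "is_hom h" "\<And>c. h c \<in> S" "u \<in> S" "v \<in> S"
  shows "\<exists>w\<in>S. poly (map_poly h P) (u + v)
    = poly (map_poly h P) u + v * poly (map_poly h (pderiv P)) u + v\<^sup>2 * w"
  unfolding pderiv_map_poly_hom[OF assms(2), symmetric]
  using assms by (intro poly_taylor2) (auto simp: coeff_map_poly[of h] is_hom_0[of h])

lemma ev2_diff_factor_outer:
  assumes "is_subring S" "is_hom h" "\<And>c. h c \<in> S" "u \<in> S" "u' \<in> S" "v \<in> S"
  shows "\<exists>w\<in>S. ev2 h P u v - ev2 h P u' v = (u - u') * w"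
  unfolding ev2_def using assms by (intro eval_diff_factor is_hom_eval subring_eval)

text \<open>The increment \<open>z\<close> ranges over the whole ring, as it will contain
  \<open>x\<close>. The linear coefficient \<open>l\<close> is independent of \<open>z\<close> and
  stays in \<open>S\<close>; the quadratic remainder is left unrestricted, since it will carry a
  surplus factor \<open>b\<close>.\<close>

lemma ev2_taylor2_inner:
  fixes h :: "'a::idom \<Rightarrow> 'b::idom"
  assumes "is_subring S" "is_hom h" "\<And>c. h c \<in> S" "u \<in> S" "v \<in> S"
  shows "\<exists>l\<in>S. \<forall>z. \<exists>w. ev2 h P u (v + z) = ev2 h P u v + z * l + z\<^sup>2 * w"
proof (induction P)
  case 0
  show ?case using assms by (auto intro!: bexI[of _ 0] exI[of _ 0] subring_intros simp: ev2_def)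
next
  case (pCons c P)
  then obtain l where l: "l \<in> S" "\<And>z. \<exists>w. ev2 h P u (v + z) = ev2 h P u v + z * l + z\<^sup>2 * w"
    by blast
  let ?l = "poly (map_poly h (pderiv c)) v"
  show ?case
  proof (intro bexI allI)
    fix z
    obtain w where "ev2 h P u (v + z) = ev2 h P u v + z * l + z\<^sup>2 * w"
      using l(2) by blast
    moreover obtain w' where "poly (map_poly h c) (v + z)
        = poly (map_poly h c) v + z * ?l + z\<^sup>2 * w'"
      using eval_taylor2[OF is_subring_UNIV assms(2), of v z c] by auto
    ultimately show "\<exists>w. ev2 h (pCons c P) u (v + z)
        = ev2 h (pCons c P) u v + z * (?l + u * l) + z\<^sup>2 * w"
      by (intro exI[of _ "w' + u * w"]) (simp add: ev2_pCons assms(2) algebra_simps)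
  qed (use assms l in \<open>auto intro!: subring_intros subring_eval\<close>)
qed

section \<open>Congruences modulo constants\<close>

lemma dvd_trans_diff: "m dvd u - v \<Longrightarrow> m dvd v - w \<Longrightarrow> m dvd u - (w::'a::comm_ring_1)"
  using dvd_add[of m "u - v" "v - w"] by simp

lemma const_poly_dvd_mono:
  assumes "m dvd n" "[:n:] dvd (P :: 'a::comm_ring_1 poly)"
  shows "[:m:] dvd P"
proof -
  obtain k where "n = m * k" using assms(1) by (rule dvdE)
  then have "[:n:] = [:m:] * [:k:]" by simp
  then have "[:m:] dvd [:n:]" by (rule dvdI)
  then show ?thesis using assms(2) by (rule dvd_trans)
qed

lemma dvd_trans_diff': "m dvd u - v \<Longrightarrow> m dvd u - w \<Longrightarrow> m dvd v - (w::'a::comm_ring_1)"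
  using dvd_diff[of m "u - w" "u - v"] by simp

lemma pcompose_id_left [simp]: "pcompose [:0, 1:] P = (P :: 'a::comm_ring_1 poly)"
  by (simp add: pcompose_pCons)

lemma pcompose_cong_left:
  fixes P :: "'a::comm_ring_1 poly"
  assumes "[:m:] dvd P - Q"
  shows "[:m:] dvd pcompose P R - pcompose Q R"
proof -
  obtain S where "P - Q = [:m:] * S" using assms by (rule dvdE)
  then have "pcompose P R - pcompose Q R = [:m:] * pcompose S R"
    unfolding pcompose_diff[symmetric] by (simp only: pcompose_mult pcompose_const)
  then show ?thesis by (rule dvdI)
qed

lemma eval_diff_dvd: "is_hom h \<Longrightarrow> u - v dvd poly (map_poly h P) u - poly (map_poly h P) v"
  using eval_diff_factor[OF is_subring_UNIV, of h u v P] by (auto simp: dvd_def)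

lemma pcompose_diff_dvd: "u - v dvd pcompose P u - pcompose P (v :: 'a::comm_ring_1 poly)"
  unfolding pcompose_altdef by (intro eval_diff_dvd is_hom_const)

text \<open>Newton-type iteration: a correction by \<open>E\<close> squares the error modulus.\<close>

lemma pcompose_right_inverse:
  fixes r :: "'a::comm_ring_1"
  assumes G: "[:r:] dvd G - [:0, 1:]"
  shows "\<exists>H. [:r:] dvd H - [:0, 1:] \<and> [:r ^ Suc k:] dvd pcompose G H - [:0, 1:]"
proof (induction k)
  case 0
  show ?case using G by (intro exI[of _ "[:0, 1:]"]) simp
next
  case (Suc k)
  then obtain H where H: "[:r:] dvd H - [:0, 1:]" "[:r ^ Suc k:] dvd pcompose G H - [:0, 1:]"
    by blast
  define E where "E = pcompose G H - [:0, 1:]"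
  then obtain N where N: "E = [:r ^ Suc k:] * N"
    using H(2) by (auto elim: dvdE)
  let ?V = "[:0, 1:] - E"
  have rE: "[:r:] dvd E"
    unfolding N by (rule const_poly_dvd_mono[of r "r ^ Suc k"], simp, rule dvd_triv_left)
  have 1: "[:r:] dvd pcompose H ?V - [:0, 1:]"
  proof (rule dvd_trans_diff)
    show "[:r:] dvd pcompose H ?V - ?V"
      using pcompose_cong_left[OF H(1), of ?V] by (simp only: pcompose_id_left)
    show "[:r:] dvd ?V - [:0, 1:]" using rE by simp
  qed
  \<comment> \<open>Since \<open>G(H) = T + E\<close>, substituting \<open>?V = T - E\<close> leaves
    the error \<open>E(?V) - E(T)\<close>. This has one factor \<open>r ^ Suc k\<close> from
    \<open>E\<close> and a second one from \<open>?V - T = -E\<close>.\<close>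
  have "pcompose G (pcompose H ?V) = pcompose ([:0, 1:] + E) ?V"
    by (simp add: pcompose_assoc E_def)
  also have "\<dots> = [:0, 1:] + [:r ^ Suc k:] * (pcompose N ?V - pcompose N [:0, 1:])"
    unfolding pcompose_add pcompose_id_left
    by (simp add: N pcompose_mult pcompose_smult smult_diff_right)
  finally have eq: "pcompose G (pcompose H ?V) - [:0, 1:]
      = [:r ^ Suc k:] * (pcompose N ?V - pcompose N [:0, 1:])" by simp
  have "?V - [:0, 1:] = [:r ^ Suc k:] * - N" by (simp add: N)
  then have "[:r ^ Suc k:] dvd ?V - [:0, 1:]" by (rule dvdI)
  then have "[:r ^ Suc k:] dvd pcompose N ?V - pcompose N [:0, 1:]"
    by (rule dvd_trans[OF _ pcompose_diff_dvd])
  then have "[:r ^ Suc k:] * [:r ^ Suc k:] dvd pcompose G (pcompose H ?V) - [:0, 1:]"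
    unfolding eq by (intro mult_dvd_mono dvd_refl)
  moreover have "[:r ^ Suc k:] * [:r ^ Suc k:] = [:r ^ Suc (Suc k):] * [:r ^ k:]"
    by (simp add: algebra_simps)
  ultimately have "[:r ^ Suc (Suc k):] dvd pcompose G (pcompose H ?V) - [:0, 1:]"
    by (simp only: dvd_mult_left)
  with 1 show ?case by blast
qed

text \<open>A right inverse \<open>H\<close> of \<open>G\<close> is again congruent to
  \<open>T\<close> modulo \<open>r\<close>, so it has a right inverse \<open>K\<close>. Modulo
  \<open>m\<close>, the composite \<open>G(H(K))\<close> is both \<open>G\<close> and
  \<open>K\<close>; hence \<open>K\<close> agrees with \<open>G\<close>, and \<open>H\<close> is a
  left inverse too.\<close>

lemma pcompose_inverse_unipotent:
  fixes r :: "'a::comm_ring_1"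
  assumes G: "[:r:] dvd G - [:0, 1:]" and m: "m dvd r ^ k" "r dvd m"
  shows "\<exists>H. [:m:] dvd pcompose G H - [:0, 1:] \<and> [:m:] dvd pcompose H G - [:0, 1:]"
proof -
  have mk: "m dvd r ^ Suc k" using m by (simp add: dvd_mult)
  obtain H where H: "[:r:] dvd H - [:0, 1:]" "[:m:] dvd pcompose G H - [:0, 1:]"
    using pcompose_right_inverse[OF G, of k] const_poly_dvd_mono[OF mk] by blast
  obtain K where K: "[:m:] dvd pcompose H K - [:0, 1:]"
    using pcompose_right_inverse[OF H(1), of k] const_poly_dvd_mono[OF mk] by blast
  have "[:m:] dvd pcompose G (pcompose H K) - pcompose G [:0, 1:]"
    using pcompose_diff_dvd K dvd_trans by blast
  moreover have "[:m:] dvd pcompose (pcompose G H) K - pcompose [:0, 1:] K"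
    by (intro pcompose_cong_left H)
  ultimately have "[:m:] dvd K - G"
    by (metis dvd_trans_diff' pcompose_assoc pcompose_id_left pcompose_idR)
  then have "[:m:] dvd pcompose H K - pcompose H G"
    using pcompose_diff_dvd dvd_trans by blast
  with K have "[:m:] dvd pcompose H G - [:0, 1:]"
    by (metis dvd_trans_diff')
  with H show ?thesis by blast
qed

text \<open>The linear polynomial \<open>?U\<close> is invertible modulo \<open>m\<close> with
  inverse \<open>?E\<close>, so \<open>?E \<circ> G\<close> falls under the unipotent case. If
  \<open>H\<close> inverts \<open>?E \<circ> G\<close>, then \<open>H \<circ> ?E\<close> inverts
  \<open>G\<close>.\<close>

lemma pcompose_inverse_mod:
  fixes r :: "'a::comm_ring_1"
  assumes G: "[:r:] dvd G - [:c, u:]" and m: "m dvd r ^ k" "r dvd m"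
    and e: "m dvd e * u - 1"
  shows "\<exists>H. [:m:] dvd pcompose G H - [:0, 1:] \<and> [:m:] dvd pcompose H G - [:0, 1:]"
proof -
  let ?E = "[:- (e * c), e:]" and ?U = "[:c, u:]"
  obtain z where z: "e * u = 1 + m * z"
    using e by (metis dvdE diff_add_cancel add.commute)
  have EU: "[:m:] dvd pcompose ?E ?U - [:0, 1:]" and UE: "[:m:] dvd pcompose ?U ?E - [:0, 1:]"
  proof -
    have "pcompose ?E ?U - [:0, 1:] = [:m:] * [:0, z:]"
      using z by (simp add: pcompose_pCons algebra_simps)
    then show "[:m:] dvd pcompose ?E ?U - [:0, 1:]" by (rule dvdI)
    have "pcompose ?U ?E - [:0, 1:] = [:m:] * [:- (c * z), z:]"
      using z by (simp add: pcompose_pCons algebra_simps)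
    then show "[:m:] dvd pcompose ?U ?E - [:0, 1:]" by (rule dvdI)
  qed
  have "[:r:] dvd pcompose ?E G - pcompose ?E ?U"
    using G pcompose_diff_dvd dvd_trans by blast
  then have "[:r:] dvd pcompose ?E G - [:0, 1:]"
    using const_poly_dvd_mono[OF m(2) EU] dvd_trans_diff by blast
  then obtain H where H: "[:m:] dvd pcompose (pcompose ?E G) H - [:0, 1:]"
      "[:m:] dvd pcompose H (pcompose ?E G) - [:0, 1:]"
    using pcompose_inverse_unipotent[OF _ m] by blast
  have "[:m:] dvd pcompose ?U (pcompose (pcompose ?E G) H) - pcompose ?U [:0, 1:]"
    using H(1) pcompose_diff_dvd dvd_trans by blast
  then have "[:m:] dvd pcompose (pcompose ?U ?E) (pcompose G H) - ?U"
    by (simp only: pcompose_assoc pcompose_idR)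
  moreover have "[:m:] dvd pcompose (pcompose ?U ?E) (pcompose G H) - pcompose [:0, 1:] (pcompose G H)"
    by (intro pcompose_cong_left UE)
  ultimately have "[:m:] dvd pcompose G H - ?U"
    by (metis dvd_trans_diff' pcompose_id_left)
  then have "[:m:] dvd pcompose (pcompose G H) ?E - pcompose ?U ?E"
    by (rule pcompose_cong_left)
  then have "[:m:] dvd pcompose G (pcompose H ?E) - [:0, 1:]"
    using UE dvd_trans_diff unfolding pcompose_assoc by blast
  moreover have "[:m:] dvd pcompose (pcompose H ?E) G - [:0, 1:]"
    using H(2) by (simp only: pcompose_assoc)
  ultimately show ?thesis by blast
qed

text \<open>\<open>r\<close> is the product of the distinct primes dividing \<open>b\<close>: a new
  prime factor is multiplied in only if it does not yet divide \<open>b\<close>. The last clause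
  turns divisibility by each of these primes into divisibility by \<open>r\<close>.\<close>

lemma exists_radical:
  fixes b :: "'a::factorial_semiring"
  assumes "b \<noteq> 0"
  shows "\<exists>r k. r dvd b \<and> b dvd r ^ k \<and> (\<forall>c. (\<forall>q. prime q \<and> q dvd b \<longrightarrow> q dvd c) \<longrightarrow> r dvd c)"
  using assms
proof (induction b rule: prime_divisors_induct)
  case (unit b)
  then show ?case by (intro exI[of _ 1]) auto
next
  case (factor q b)
  then obtain r k where r: "r dvd b" "b dvd r ^ k"
    "\<And>c. (\<forall>q. prime q \<and> q dvd b \<longrightarrow> q dvd c) \<Longrightarrow> r dvd c"
    by auto
  show ?case
  proof (cases "q dvd b")
    case True
    then have "q dvd r ^ k" using r(2) dvd_trans by blast
    then have "q * b dvd r ^ (k + k)"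
      unfolding power_add using r(2) by (intro mult_dvd_mono)
    then show ?thesis
      using r by (intro exI[of _ r] exI[of _ "k + k"]) auto
  next
    case False
    have "b dvd (q * r) ^ k"
      using r(2) by (simp add: power_mult_distrib dvd_mult)
    then have "q * b dvd (q * r) ^ Suc k"
      by (simp add: mult.assoc dvd_mult mult_dvd_mono)
    moreover have "q * r dvd c" if c: "\<forall>q'. prime q' \<and> q' dvd q * b \<longrightarrow> q' dvd c" for c
    proof -
      have "r dvd c" using c by (intro r(3)) auto
      then obtain c' where c': "c = r * c'" by (auto elim: dvdE)
      have "q dvd c" using c factor by simp
      moreover have "\<not> q dvd r" using False r(1) dvd_trans by blast
      ultimately have "q dvd c'"
        using factor(1) c' by (auto simp: prime_dvd_mult_iff)
      then show ?thesis using c' by (simp add: mult.commute mult_dvd_mono)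
    qed
    ultimately show ?thesis
      using r by (intro exI[of _ "q * r"] exI[of _ "Suc k"]) (auto simp: mult_dvd_mono)
  qed
qed auto

section \<open>Degrees and algebraic independence modulo a prime\<close>

text \<open>The reduction of \<open>P\<close> modulo \<open>\<pi>\<close> is nonzero of degree
  \<open>n\<close>; this form avoids constructing the quotient ring \<open>R/\<pi>\<close>.\<close>

definition is_top :: "'a::comm_ring_1 \<Rightarrow> 'a poly \<Rightarrow> nat \<Rightarrow> bool" where
  "is_top \<pi> P n \<longleftrightarrow> \<not> \<pi> dvd coeff P n \<and> (\<forall>i>n. \<pi> dvd coeff P i)"

lemma exists_top:
  fixes P :: "'a::idom poly"
  assumes "\<not> [:\<pi>:] dvd P"
  shows "\<exists>n. is_top \<pi> P n"
proof -
  let ?Q = "\<lambda>n. \<not> \<pi> dvd coeff P n"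
  obtain n where n: "?Q n" using assms by (auto simp: const_poly_dvd_iff)
  have "\<forall>i. ?Q i \<longrightarrow> i \<le> degree P" by (metis dvd_0_right le_degree)
  then have "?Q (Greatest ?Q)" "\<And>i. ?Q i \<Longrightarrow> i \<le> Greatest ?Q"
    using n GreatestI_nat[of ?Q] Greatest_le_nat[of ?Q] by blast+
  then show ?thesis unfolding is_top_def by (meson not_le)
qed

text \<open>In the convolution sum for degree \<open>m + n\<close>, every term except the one at
  \<open>(m, n)\<close> has a factor beyond its top degree; primality keeps that one term nonzero
  modulo \<open>\<pi>\<close>.\<close>

lemma is_top_mult:
  fixes P Q :: "'a::idom poly"
  assumes "prime_elem \<pi>" "is_top \<pi> P m" "is_top \<pi> Q n"
  shows "is_top \<pi> (P * Q) (m + n)"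
proof -
  have summand: "\<pi> dvd coeff P i * coeff Q j" if "i > m \<or> j > n" for i j
    using assms that unfolding is_top_def by auto
  have "coeff (P * Q) (m + n)
      = coeff P m * coeff Q n + (\<Sum>i\<in>{..m + n} - {m}. coeff P i * coeff Q (m + n - i))"
    unfolding coeff_mult by (subst sum.remove[of _ m]) auto
  moreover have "\<pi> dvd (\<Sum>i\<in>{..m + n} - {m}. coeff P i * coeff Q (m + n - i))"
    by (intro dvd_sum summand) auto
  moreover have "\<not> \<pi> dvd coeff P m * coeff Q n"
    using assms by (auto simp: is_top_def prime_elem_dvd_mult_iff)
  ultimately have "\<not> \<pi> dvd coeff (P * Q) (m + n)"
    by (simp add: dvd_add_left_iff)
  moreover have "\<pi> dvd coeff (P * Q) k" if "k > m + n" for k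
    unfolding coeff_mult using that by (intro dvd_sum summand) auto
  ultimately show ?thesis by (simp add: is_top_def)
qed

text \<open>Degrees modulo \<open>\<pi>\<close> add up, so two factors whose product is
  \<open>1\<close> modulo \<open>\<pi>\<close> both have degree \<open>0\<close>: units of
  \<open>(R/\<pi>)[T]\<close> are constants.\<close>

lemma unit_mod_prime_const:
  fixes A S :: "'a::idom poly"
  assumes \<pi>: "prime_elem \<pi>" and "[:\<pi>:] dvd A * S - 1" and "i > 0"
  shows "\<pi> dvd coeff A i"
proof -
  have "\<not> [:\<pi>:] dvd 1"
    using \<pi> by (auto simp: one_pCons prime_elem_def)
  then have "\<not> [:\<pi>:] dvd A * S"
    using assms(2) by (metis dvd_add_right_iff diff_add_cancel)
  then obtain m n where mn: "is_top \<pi> A m" "is_top \<pi> S n"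
    using exists_top by (metis dvd_mult dvd_mult2)
  have "m + n = 0"
  proof (rule ccontr)
    assume "m + n \<noteq> 0"
    then have "coeff (A * S - 1) (m + n) = coeff (A * S) (m + n)"
      by (cases "m + n") simp_all
    then have "\<pi> dvd coeff (A * S) (m + n)"
      using assms(2) by (metis const_poly_dvd_iff)
    then show False using is_top_mult[OF \<pi> mn] by (simp add: is_top_def)
  qed
  then show ?thesis using mn(1) \<open>i > 0\<close> by (simp add: is_top_def)
qed

text \<open>Substituting \<open>v\<close> is injective on \<open>(R/\<pi>)[T]\<close>: in a Horner
  step \<open>c + v * P(v)\<close> the product has positive degree \<open>n + k\<close> modulo
  \<open>\<pi>\<close>, so the constant \<open>c\<close> cannot cancel its top term.\<close>

lemma prime_not_dvd_pcompose:
  fixes P v :: "'a::idom poly"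
  assumes \<pi>: "prime_elem \<pi>" and v: "is_top \<pi> v n" "n > 0" and "\<not> [:\<pi>:] dvd P"
  shows "\<not> [:\<pi>:] dvd pcompose P v"
  using assms(4)
proof (induction P)
  case (pCons c P)
  show ?case
  proof (cases "[:\<pi>:] dvd P")
    case True
    then have "\<not> \<pi> dvd c"
      using pCons(3) unfolding const_poly_dvd_iff by (metis coeff_pCons_0 coeff_pCons_Suc not0_implies_Suc)
    then have "\<not> [:\<pi>:] dvd [:c:]" by simp
    moreover have "[:\<pi>:] dvd pcompose P v"
      using pcompose_cong_left[of \<pi> P 0 v] True by simp
    ultimately show ?thesis
      unfolding pcompose_pCons by (metis dvd_add_left_iff dvd_mult)
  next
    case False
    then obtain k where "is_top \<pi> (pcompose P v) k"
      using pCons(2) exists_top by blast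
    then have "is_top \<pi> (v * pcompose P v) (n + k)"
      using \<pi> v(1) by (intro is_top_mult)
    moreover have "coeff (pcompose (pCons c P) v) (n + k) = coeff (v * pcompose P v) (n + k)"
      using \<open>n > 0\<close> by (cases "n + k") (simp_all add: pcompose_pCons)
    ultimately show ?thesis by (metis is_top_def const_poly_dvd_iff)
  qed
qed simp

text \<open>Splits the evaluation into two one-variable substitutions, first in the coefficients and
  then in the outer variable, so that injectivity of substitution can be applied twice.\<close>

lemma ev2_C2_const_inner: "ev2 C2 P v [:u:] = pcompose (map_poly (\<lambda>c. pcompose c u) P) v"
proof -
  have "poly (map_poly C2 c) [:u:] = [:pcompose c u:]" for c
    using hom_eval[OF is_hom_const is_hom_const, of c u] by (simp add: pcompose_altdef C2_def[abs_def])
  then show ?thesis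
    by (simp add: ev2_def pcompose_altdef[of _ v] map_poly_map_poly o_def)
qed

text \<open>Over the domain \<open>R/\<pi>\<close>, a nonconstant \<open>u \<in> R[y]\<close> and a \<open>v\<close> of positive
  \<open>x\<close>-degree are algebraically independent.\<close>

lemma prime_dvd_ev2:
  fixes u v :: "'a::idom poly poly"
  assumes \<pi>: "prime_elem \<pi>"
    and u: "C2 \<pi> dvd u - [:u0:]" "is_top \<pi> u0 m" "m > 0"
    and v: "C2 \<pi> dvd v - v0" "is_top [:\<pi>:] v0 n" "n > 0"
    and P: "C2 \<pi> dvd ev2 C2 P v u"
  shows "C2 \<pi> dvd P"
proof (rule ccontr)
  assume "\<not> C2 \<pi> dvd P"
  then obtain i where "\<not> [:\<pi>:] dvd coeff P i"
    by (auto simp: C2_def const_poly_dvd_iff)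
  then have "\<not> [:\<pi>:] dvd pcompose (coeff P i) u0"
    using prime_not_dvd_pcompose[OF \<pi> u(2,3)] by blast
  then have "\<not> [:[:\<pi>:]:] dvd map_poly (\<lambda>c. pcompose c u0) P"
    by (auto simp: const_poly_dvd_iff[of "[:\<pi>:]"] coeff_map_poly)
  then have "\<not> C2 \<pi> dvd ev2 C2 P v0 [:u0:]"
    unfolding ev2_C2_const_inner C2_def
    by (intro prime_not_dvd_pcompose[OF lift_prime_elem_poly[OF \<pi>] v(2,3)])
  moreover have "C2 \<pi> dvd ev2 C2 P v u - ev2 C2 P v0 u"
    using ev2_diff_factor_outer[OF is_subring_UNIV, of C2 v v0 u P] v(1) by auto
  moreover have "C2 \<pi> dvd ev2 C2 P v0 u - ev2 C2 P v0 [:u0:]"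
  proof (induction P)
    case (pCons c P)
    have "C2 \<pi> dvd poly (map_poly C2 c) u - poly (map_poly C2 c) [:u0:]"
      using eval_diff_dvd[of C2 u "[:u0:]" c] u(1) by (auto intro: dvd_trans)
    then have "C2 \<pi> dvd poly (map_poly C2 c) u - poly (map_poly C2 c) [:u0:]
        + v0 * (ev2 C2 P v0 u - ev2 C2 P v0 [:u0:])"
      using pCons by (intro dvd_add dvd_mult)
    then show ?case by (simp add: ev2_pCons algebra_simps)
  qed (simp add: ev2_def)
  ultimately show False
    using P dvd_trans_diff[of "C2 \<pi>" "ev2 C2 P v u" "ev2 C2 P v0 u" "ev2 C2 P v0 [:u0:]"]
      dvd_diff[of "C2 \<pi>" "ev2 C2 P v u" "ev2 C2 P v u - ev2 C2 P v0 [:u0:]"] by simp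
qed

text \<open>Plays the part of \<open>C[1/a]\<close> within the ambient ring, without
  fractions.\<close>

definition sat :: "'a::comm_ring_1 \<Rightarrow> 'a set \<Rightarrow> 'a set" where
  "sat a C = {u. \<exists>n. a ^ n * u \<in> C}"

lemma sat_superset: "C \<subseteq> sat a C"
  unfolding sat_def by (auto intro: exI[of _ 0])

lemma is_subring_sat:
  assumes "is_subring C" "a \<in> C"
  shows "is_subring (sat a C)"
proof -
  have "u - v \<in> sat a C \<and> u * v \<in> sat a C" if uv: "u \<in> sat a C" "v \<in> sat a C" for u v
  proof -
    obtain m n where mn: "a ^ m * u \<in> C" "a ^ n * v \<in> C"
      using uv by (auto simp: sat_def)
    have "a ^ n * (a ^ m * u) - a ^ m * (a ^ n * v) \<in> C" "(a ^ m * u) * (a ^ n * v) \<in> C"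
      using mn assms by (auto intro!: subring_intros)
    then have "a ^ (m + n) * (u - v) \<in> C" "a ^ (m + n) * (u * v) \<in> C"
      by (simp_all add: power_add algebra_simps)
    then show ?thesis by (auto simp: sat_def)
  qed
  then show ?thesis
    using sat_superset[of C a] is_subringD(1)[OF assms(1)] by (auto simp: is_subring_def)
qed

lemma sat_cancel: "a ^ k * u \<in> sat a C \<Longrightarrow> u \<in> sat a C"
  by (auto simp: sat_def simp flip: mult.assoc power_add)

section \<open>Coordinates\<close>

lemma ev2_pcompose:
  assumes "is_hom h"
  shows "ev2 h (pcompose P Q) u v = ev2 h P (ev2 h Q u v) v"
proof (rule ev2_unique[where g = "\<lambda>P. ev2 h (pcompose P Q) u v"])
  show "is_hom (\<lambda>P. ev2 h (pcompose P Q) u v)"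
    using is_hom_ev2[OF assms, of u v]
    by (auto simp: is_hom_def pcompose_1 pcompose_add pcompose_mult)
qed (use assms in \<open>auto simp: ev2_const ev2_y\<close>)

text \<open>Modulo \<open>m\<close>, \<open>\<Lambda>\<close> is \<open>G(Y0)\<close>, so
  \<open>Y0\<close> is congruent to \<open>H(\<Lambda>)\<close> and \<open>L\<close> is the quotient
  of the difference by \<open>m\<close>. Conversely \<open>Y0\<close> is a polynomial in
  \<open>Y1\<close>, \<open>\<Lambda>\<close>, \<open>L\<close>; expanding \<open>G(Y0)\<close>
  around \<open>H(\<Lambda>)\<close> and cancelling \<open>m\<close> recovers
  \<open>Y2\<close>.\<close>

lemma coordinate_of_inverse:
  fixes G H :: "'a::idom poly poly"
  defines "Y0 \<equiv> [:0, 1:] :: 'a poly poly poly"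
    and "Y1 \<equiv> [:[:0, 1:]:] :: 'a poly poly poly"
    and "Y2 \<equiv> [:[:[:0, 1:]:]:] :: 'a poly poly poly"
  assumes m: "m \<noteq> 0" and GH: "[:[:m:]:] dvd pcompose G H - [:0, 1:]"
    and HG: "[:[:m:]:] dvd pcompose H G - [:0, 1:]"
    and \<Lambda>: "\<Lambda> = C3 m * Y2 + ev2 C3 G Y0 Y1"
  obtains L where "Y0 = ev2 C3 H \<Lambda> Y1 + C3 m * L" "range (\<lambda>P. ev3 C3 P Y1 \<Lambda> L) = UNIV"
proof -
  note C3_hom = hom_simps[OF is_hom_C3] and ev2_hom = hom_simps[OF is_hom_ev2[OF is_hom_C3]]
  have Cm: "C3 m \<noteq> 0" using m by (simp add: C3_def)
  obtain W where "pcompose H G - [:0, 1:] = [:[:m:]:] * W" using HG by (rule dvdE)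
  then have HG': "pcompose H G = [:0, 1:] + [:[:m:]:] * W" by (simp add: algebra_simps)
  obtain V where "pcompose G H - [:0, 1:] = [:[:m:]:] * V" using GH by (rule dvdE)
  then have GH': "pcompose G H = [:0, 1:] + [:[:m:]:] * V" by (simp add: algebra_simps)
  have "ev2 C3 H (ev2 C3 G Y0 Y1) Y1 = Y0 + C3 m * ev2 C3 W Y0 Y1"
    unfolding ev2_pcompose[OF is_hom_C3, symmetric] HG' ev2_hom
    by (simp only: ev2_const ev2_x is_hom_C3)
  moreover obtain w where "ev2 C3 H \<Lambda> Y1 - ev2 C3 H (ev2 C3 G Y0 Y1) Y1
      = (\<Lambda> - ev2 C3 G Y0 Y1) * w"
    using ev2_diff_factor_outer[OF is_subring_UNIV is_hom_C3] by blast
  ultimately have "Y0 = ev2 C3 H \<Lambda> Y1 + C3 m * (- ev2 C3 W Y0 Y1 - Y2 * w)"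
    unfolding \<Lambda> by (simp add: algebra_simps)
  then obtain L where L: "Y0 = ev2 C3 H \<Lambda> Y1 + C3 m * L" by blast
  define D where "D = range (\<lambda>P. ev3 C3 P Y1 \<Lambda> L)"
  have sub: "is_subring D"
    unfolding D_def by (intro is_subring_range is_hom_ev3) simp
  have C3D: "C3 c \<in> D" for c
    unfolding D_def by (rule range_eqI[of _ _ "C3 c"]) (simp add: ev3_C3)
  have "Y1 = ev3 C3 [:0, 1:] Y1 \<Lambda> L" "\<Lambda> = ev3 C3 [:[:0, 1:]:] Y1 \<Lambda> L"
    "L = ev3 C3 [:[:[:0, 1:]:]:] Y1 \<Lambda> L"
    by (simp_all add: ev3_y0 ev3_y1 ev3_y2)
  then have gens: "Y1 \<in> D" "\<Lambda> \<in> D" "L \<in> D"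
    unfolding D_def by (metis rangeI)+
  have HD: "ev2 C3 P u Y1 \<in> D" if "u \<in> D" for P u
    using sub C3D that gens by (intro subring_ev2) auto
  have Y0: "Y0 \<in> D"
    unfolding L using sub C3D gens HD by (intro subring_intros)
  \<comment> \<open>The expansion is carried out inside \<open>D\<close>: the cofactor
    \<open>w'\<close> appears in the formula for \<open>Y2\<close> below and has to lie in
    \<open>D\<close>.\<close>
  obtain w' where w': "w' \<in> D" "ev2 C3 G Y0 Y1 - ev2 C3 G (ev2 C3 H \<Lambda> Y1) Y1
      = (Y0 - ev2 C3 H \<Lambda> Y1) * w'"
    using ev2_diff_factor_outer[OF sub is_hom_C3 C3D Y0 HD[OF gens(2)] gens(1)] by metis
  have "ev2 C3 G (ev2 C3 H \<Lambda> Y1) Y1 = \<Lambda> + C3 m * ev2 C3 V \<Lambda> Y1"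
    unfolding ev2_pcompose[OF is_hom_C3, symmetric] GH' ev2_hom
    by (simp only: ev2_const ev2_x is_hom_C3)
  moreover have "Y0 - ev2 C3 H \<Lambda> Y1 = C3 m * L" "ev2 C3 G Y0 Y1 = \<Lambda> - C3 m * Y2"
    by (subst L, simp) (simp add: \<Lambda>)
  ultimately have "(\<Lambda> - C3 m * Y2) - (\<Lambda> + C3 m * ev2 C3 V \<Lambda> Y1) = C3 m * L * w'"
    using w'(2) by simp
  then have "C3 m * Y2 = C3 m * (- ev2 C3 V \<Lambda> Y1 - L * w')"
    by algebra
  then have "Y2 = - ev2 C3 V \<Lambda> Y1 - L * w'"
    using Cm by (simp only: mult_cancel_left simp_thms)
  then have "Y2 \<in> D"
    using sub HD gens w' by (auto intro!: subring_intros)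
  then have "P \<in> D" for P
    using subring_ev3[OF sub is_hom_C3 C3D Y0 gens(1), of Y2 P] 
    by (simp add: Y0_def Y1_def Y2_def ev3_C3_id)
  then have "D = UNIV" by blast
  with L that show ?thesis unfolding D_def by blast
qed

section \<open>Coefficient subrings, characteristic \<open>p\<close> and composition\<close>

lemma is_subring_coeffs:
  assumes "is_subring C"
  shows "is_subring {Q. \<forall>i. coeff Q i \<in> C}"
proof -
  have sum_in: "sum g A \<in> C" if "\<And>i. g i \<in> C" for g and A :: "nat set"
    by (induction A rule: infinite_finite_induct) (use that assms in \<open>auto intro: subring_intros\<close>)
  have "coeff 1 i \<in> C" for i
    using assms by (auto simp: coeff_1 intro: subring_intros)
  then show ?thesis
    unfolding is_subring_def using assms
    by (auto simp: coeff_mult intro!: sum_in intro: subring_intros)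
qed

lemma is_subring_image:
  assumes "is_hom g" "is_subring S"
  shows "is_subring (g ` S)"
  using assms(2) unfolding is_subring_def
  by (auto simp: is_hom_1[OF assms(1)] is_hom_diff[OF assms(1), symmetric]
      is_hom_mult[OF assms(1), symmetric] intro!: image_eqI[where f = g])

lemma inj_on_of_nat_CHAR: "inj_on (of_nat :: nat \<Rightarrow> 'a::ring_1) {..<CHAR('a)}"
proof (rule linorder_inj_onI)
  fix i j :: nat
  assume ij: "i < j" "i \<in> {..<CHAR('a)}" "j \<in> {..<CHAR('a)}"
  then have "\<not> CHAR('a) dvd j - i" by (auto dest!: dvd_imp_le)
  then have "(of_nat (j - i) :: 'a) \<noteq> 0" by (simp add: of_nat_eq_0_iff_char_dvd)
  then show "of_nat i \<noteq> (of_nat j :: 'a)" using ij by simp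
qed auto

text \<open>Bezout for \<open>n\<close> and the prime \<open>p\<close>. It serves to pass from
  divisibility of the coefficients of a derivative to divisibility of the coefficients of the
  polynomial itself.\<close>

lemma of_nat_invertible_mod_CHAR:
  assumes "CHAR('a::idom) = p" "p > 0" "\<not> p dvd n"
  shows "\<exists>m. of_nat m * of_nat n = (1 :: 'a)"
proof -
  have "prime p" using prime_CHAR_semidom[where 'a = 'a] assms by simp
  then have "coprime n p" using assms(3) prime_imp_coprime by (metis coprime_commute)
  then obtain x y where xy: "n * x = p * y + 1"
    using coprime_bezout_strong[of n p] prime_gt_1_nat[OF \<open>prime p\<close>] by auto
  have "of_nat x * of_nat n = (of_nat (p * y + 1) :: 'a)"
    unfolding xy[symmetric] by (simp only: of_nat_mult mult.commute)
  also have "\<dots> = of_nat p * of_nat y + 1" by (simp only: of_nat_add of_nat_mult of_nat_1)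
  also have "of_nat p = (0 :: 'a)" using of_nat_CHAR[where 'a = 'a] unfolding assms(1) .
  also have "0 * of_nat y + 1 = (1 :: 'a)" by simp
  finally show ?thesis by blast
qed

lemma eval_pcompose:
  assumes "is_hom h"
  shows "poly (map_poly h (pcompose P Q)) u = poly (map_poly h P) (poly (map_poly h Q) u)"
proof (rule eval_unique[where g = "\<lambda>P. poly (map_poly h (pcompose P Q)) u"])
  show "is_hom (\<lambda>P. poly (map_poly h (pcompose P Q)) u)"
    using is_hom_eval[OF assms, of u]
    by (auto simp: is_hom_def pcompose_1 pcompose_add pcompose_mult)
qed (use assms in \<open>auto simp: eval_const\<close>)

lemma eval_monom:
  assumes "is_hom h"
  shows "poly (map_poly h (monom c n)) u = h c * u ^ n"
  using map_poly_monom[of h c n] is_hom_0[OF assms] by (simp add: poly_monom)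

section \<open>Invariants of the automorphism\<close>

lemmas C2_hom = hom_simps[OF is_hom_C2]

abbreviation (input) evC :: "'a::comm_ring_1 poly \<Rightarrow> 'a poly poly \<Rightarrow> 'a poly poly" where
  "evC P u \<equiv> poly (map_poly C2 P) u"

lemmas evC_hom = hom_simps[OF is_hom_eval[OF is_hom_C2]]

lemma evC_Y: "evC P [:[:0, 1:]:] = [:P:]"
  by (rule eval_unique[symmetric, where g = "\<lambda>P. [:P:]"]) (auto simp: is_hom_const C2_def)

text \<open>Of the gcd \<open>d\<close> only the resulting decompositions of \<open>a\<close> and
  \<open>\<theta>\<close> are recorded. In the application \<open>smult d \<rho>\<close> collects
  the terms of \<open>\<theta>\<close> whose exponent is prime to \<open>p\<close>, and
  \<open>\<theta>s(y^p)\<close> the others.\<close>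

locale order_p_automorphism =
  fixes p :: nat and a b d :: "'a::{factorial_semiring, idom_divide}"
    and \<theta> \<rho> \<theta>s G :: "'a poly" and X Y f F q q1 \<phi>x :: "'a poly poly"
    and \<phi> :: "'a poly poly \<Rightarrow> 'a poly poly"
  assumes char: "CHAR('a) = p" and ppos: "p > 0"
    and a_eq: "a = b * d" and a_nz: "a \<noteq> 0"
    and \<theta>_eq: "\<theta> = smult d \<rho> + pcompose \<theta>s (monom 1 p)"
    and X_def: "X = [:0, 1:]" and Y_def: "Y = [:[:0, 1:]:]"
    and f_eq: "f = C2 a * X + evC \<theta> Y"
    and F_eq: "F = evC G f" and F_nz: "F \<noteq> 0"
    and q_eq: "q = Y ^ p - (C2 a * F) ^ (p - 1) * Y"
    and q1_def: "q1 = (f - evC \<theta>s q) div C2 d"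
    and \<phi>x_def: "\<phi>x = X + (evC \<theta> Y - evC \<theta> (Y + C2 a * F)) div C2 a"
    and \<phi>_def: "\<phi> = (\<lambda>u. ev2 C2 u \<phi>x (Y + C2 a * F))"
begin

lemma b_nz: "b \<noteq> 0" and d_nz: "d \<noteq> 0"
  using a_eq a_nz by auto

lemma C2_nz: "C2 a \<noteq> 0" "C2 b \<noteq> 0" "C2 d \<noteq> 0"
  using b_nz d_nz a_nz by (auto simp: C2_def)

lemma C2_a: "C2 a = C2 b * C2 d"
  by (simp add: a_eq C2_hom)

lemma p_prime: "prime p"
  using prime_CHAR_semidom[where 'a = 'a] char ppos by simp

lemma p_ge_2: "p \<ge> 2"
  using p_prime by (rule prime_ge_2_nat)

lemma frobenius: "(u + v) ^ p = u ^ p + v ^ p" for u v :: "'a poly poly"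
  using char p_prime by (intro freshmans_dream) simp_all

lemma evC_\<theta>: "evC \<theta> u = C2 d * evC \<rho> u + evC \<theta>s (u ^ p)"
proof -
  have "smult d \<rho> = [:d:] * \<rho>" by simp
  then show ?thesis
    unfolding \<theta>_eq by (simp only: evC_hom eval_const eval_pcompose eval_monom is_hom_C2 C2_hom mult_1)
qed

text \<open>\<open>\<theta>s(Y^p) - \<theta>s(q)\<close> is a multiple of
  \<open>Y^p - q = (a F)^(p-1) Y\<close>, which contains the factor \<open>a = b d\<close> because
  \<open>p \<ge> 2\<close>. Taking \<open>V\<close> to be everything makes the division by
  \<open>d\<close> in \<open>q1\<close> exact; a smaller \<open>V\<close> controls where
  \<open>x\<close> occurs in \<open>q1\<close>.\<close>

lemma q1_form:
  assumes V: "is_subring V" "\<And>c. C2 c \<in> V" "Y \<in> V" "F \<in> V"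
  shows "\<exists>v\<in>V. C2 d * (evC \<rho> Y + C2 b * (X + v)) = f - evC \<theta>s q"
proof -
  have qV: "q \<in> V" unfolding q_eq using V by (intro subring_intros)
  then obtain w where w: "w \<in> V" "evC \<theta>s (Y ^ p) - evC \<theta>s q = (Y ^ p - q) * w"
    using eval_diff_factor[OF V(1) is_hom_C2 V(2), of "Y ^ p" q \<theta>s] V by (auto intro: subring_intros)
  have "p - 1 = Suc (p - 2)" using p_ge_2 by simp
  then have "Y ^ p - q = C2 a * (F * (C2 a * F) ^ (p - 2) * Y)"
    by (simp add: q_eq mult_ac)
  then have "evC \<theta>s (Y ^ p) - evC \<theta>s q = C2 d * (C2 b * (F * (C2 a * F) ^ (p - 2) * Y * w))"
    unfolding w by (simp add: C2_a mult_ac)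
  then have "f - evC \<theta>s q = C2 d * (evC \<rho> Y + C2 b * (X + F * (C2 a * F) ^ (p - 2) * Y * w))"
    by (simp add: f_eq evC_\<theta> C2_a algebra_simps)
  moreover have "F * (C2 a * F) ^ (p - 2) * Y * w \<in> V"
    using V w by (intro subring_intros)
  ultimately show ?thesis by metis
qed

lemma q1_eq: "C2 d * q1 = f - evC \<theta>s q"
proof -
  have "C2 d dvd f - evC \<theta>s q"
    using q1_form[OF is_subring_UNIV] by (metis UNIV_I dvd_triv_left)
  then show ?thesis unfolding q1_def by simp
qed

lemma q1_form':
  assumes V: "is_subring V" "\<And>c. C2 c \<in> V" "Y \<in> V" "F \<in> V"
  shows "\<exists>v\<in>V. q1 = evC \<rho> Y + C2 b * (X + v)"
  using q1_form[OF V] C2_nz(3) unfolding q1_eq[symmetric] by auto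

lemma \<phi>x_eq: "C2 a * \<phi>x = C2 a * X + (evC \<theta> Y - evC \<theta> (Y + C2 a * F))"
proof -
  have "Y - (Y + C2 a * F) dvd evC \<theta> Y - evC \<theta> (Y + C2 a * F)"
    by (intro eval_diff_dvd is_hom_C2)
  then have "C2 a dvd evC \<theta> Y - evC \<theta> (Y + C2 a * F)"
    by (simp add: dvd_mult_left)
  then show ?thesis unfolding \<phi>x_def by (simp add: distrib_left)
qed

lemma is_hom_\<phi>: "is_hom \<phi>"
  unfolding \<phi>_def by (intro is_hom_ev2 is_hom_C2)

lemmas \<phi>_hom = hom_simps[OF is_hom_\<phi>]

lemma \<phi>_C2: "\<phi> (C2 c) = C2 c" and \<phi>_X: "\<phi> X = \<phi>x" and \<phi>_Y: "\<phi> Y = Y + C2 a * F"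
  unfolding \<phi>_def X_def Y_def by (simp_all add: ev2_C2 ev2_x ev2_y)

lemma \<phi>_evC: "\<phi> (evC P u) = evC P (\<phi> u)"
  using hom_eval[OF is_hom_\<phi> is_hom_C2, of P u] by (simp only: \<phi>_C2)

lemma \<phi>_ev2: "\<phi> (ev2 C2 P u v) = ev2 C2 P (\<phi> u) (\<phi> v)"
  using hom_ev2[OF is_hom_\<phi> is_hom_C2, of P u v] by (simp only: \<phi>_C2)

lemma \<phi>_f: "\<phi> f = f"
  unfolding f_eq \<phi>_hom \<phi>_evC \<phi>_C2 \<phi>_X \<phi>_Y \<phi>x_eq by simp

lemma \<phi>_F: "\<phi> F = F"
  unfolding F_eq \<phi>_evC \<phi>_f ..

text \<open>By additivity of Frobenius, replacing \<open>Y\<close> by \<open>Y + a F\<close> adds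
  \<open>(a F)^p\<close> to \<open>Y^p\<close> and the same amount to
  \<open>(a F)^(p-1) Y\<close>.\<close>

lemma \<phi>_q: "\<phi> q = q"
proof -
  have "(C2 a * F) ^ (p - 1) * (C2 a * F) = (C2 a * F) ^ p"
    using ppos by (metis power_minus_mult)
  then show ?thesis
    unfolding q_eq \<phi>_hom \<phi>_C2 \<phi>_F \<phi>_Y frobenius by (simp add: distrib_left)
qed

lemma \<phi>_q1: "\<phi> q1 = q1"
proof -
  have "C2 d * \<phi> q1 = \<phi> (C2 d * q1)" by (simp only: \<phi>_hom \<phi>_C2)
  also have "\<dots> = C2 d * q1"
    unfolding q1_eq \<phi>_hom \<phi>_evC \<phi>_f \<phi>_q ..
  finally have "C2 d * \<phi> q1 = C2 d * q1" .
  then show ?thesis using C2_nz by simp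
qed

lemma is_subring_fixed: "is_subring {u. \<phi> u = u}"
  by (simp add: is_subring_def \<phi>_hom)

text \<open>Artin--Schreier: \<open>Y\<close> is a root of \<open>T ^ p - (aF) ^ (p - 1) T - q\<close>, so powers of \<open>Y\<close> may be reduced
  below \<open>p\<close>.\<close>

lemma reduce_degree:
  assumes C: "is_subring C" "\<And>c. C2 c \<in> C" "F \<in> C" "q \<in> C"
    and "\<And>i. coeff Q i \<in> C"
  shows "\<exists>Q'. (\<forall>i. coeff Q' i \<in> C) \<and> degree Q' < p \<and> poly Q' Y = poly Q Y"
  using assms(5)
proof (induction Q)
  case 0
  then show ?case using ppos by (intro exI[of _ 0]) simp
next
  case (pCons c Q)
  have "coeff Q i \<in> C" for i using pCons(3)[of "Suc i"] by simp
  then obtain Q' where Q': "\<And>i. coeff Q' i \<in> C" "degree Q' < p" "poly Q' Y = poly Q Y"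
    using pCons(2) by blast
  \<comment> \<open>\<open>c + T Q'\<close> has degree at most \<open>p\<close> and \<open>l\<close>
    is its coefficient at \<open>T^p\<close>; subtracting \<open>l\<close> times the monic
    polynomial \<open>M\<close>, which vanishes at \<open>Y\<close>, lowers the degree below
    \<open>p\<close>.\<close>
  define l where "l = coeff Q' (p - 1)"
  define M where "M = monom 1 p - [:q, (C2 a * F) ^ (p - 1):]"
  let ?S = "{Q. \<forall>i. coeff Q i \<in> C}"
  have S: "is_subring ?S" using C(1) by (rule is_subring_coeffs)
  have "[:q, (C2 a * F) ^ (p - 1):] \<in> ?S" "[:l:] \<in> ?S" "pCons c Q' \<in> ?S" "monom 1 p \<in> ?S"
    using C Q' pCons(3)[of 0]
    by (auto simp: coeff_pCons l_def coeff_monom split: nat.splits intro!: subring_intros)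
  then have "pCons c Q' - [:l:] * M \<in> ?S"
    unfolding M_def using S by (intro subring_intros)
  moreover have "degree (pCons c Q' - [:l:] * M) < p"
  proof -
    have "coeff (pCons c Q' - [:l:] * M) i = 0" if "i \<ge> p" for i
    proof (cases "i = p")
      case True
      then show ?thesis
        using p_ge_2 by (auto simp: M_def l_def coeff_pCons split: nat.splits)
    next
      case False
      then have "degree Q' < i - 1" using that Q'(2) by simp
      then have "coeff Q' (i - 1) = 0" by (rule coeff_eq_0)
      then show ?thesis
        using p_ge_2 that False by (auto simp: M_def coeff_pCons coeff_monom split: nat.splits)
    qed
    then show ?thesis using ppos by (metis leading_coeff_0_iff degree_0 not_le)
  qed
  moreover have "poly M Y = 0"
    by (simp add: M_def poly_monom q_eq mult.commute)
  then have "poly (pCons c Q' - [:l:] * M) Y = poly (pCons c Q) Y"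
    using Q'(3) by simp
  ultimately show ?case by blast
qed

text \<open>Writing \<open>a ^ N * u\<close> as a polynomial \<open>Q\<close> in \<open>Y\<close> of degree less than \<open>p\<close> with invariant
  coefficients, invariance gives \<open>Q (Y + i a F) = Q Y\<close> for all \<open>i < p\<close>, so \<open>Q\<close> is constant.\<close>

lemma fixed_subset_sat:
  assumes u: "\<phi> u = u"
  shows "u \<in> sat (C2 a) (range (\<lambda>P. ev2 C2 P f q))"
proof -
  define C where "C = range (\<lambda>P. ev2 C2 P f q)"
  have sub: "is_subring C"
    unfolding C_def by (intro is_subring_range is_hom_ev2 is_hom_C2)
  have C2C: "C2 c \<in> C" for c
    unfolding C_def by (rule range_eqI[of _ _ "C2 c"]) (simp add: ev2_C2)
  have "f = ev2 C2 [:0, 1:] f q" "q = ev2 C2 [:[:0, 1:]:] f q"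
    by (simp_all add: ev2_x ev2_y)
  then have gens: "f \<in> C" "q \<in> C"
    unfolding C_def by (metis rangeI)+
  have FC: "F \<in> C"
    unfolding F_eq using sub C2C gens by (intro subring_eval) auto
  have fixC: "\<phi> c = c" if "c \<in> C" for c
    using that unfolding C_def by (auto simp: \<phi>_ev2 \<phi>_f \<phi>_q)
  define D where "D = (\<lambda>Q. poly Q Y) ` {Q. \<forall>i. coeff Q i \<in> C}"
  have DI: "poly Q Y \<in> D" if "\<And>i. coeff Q i \<in> C" for Q
    using that unfolding D_def by blast
  have subD: "is_subring D"
    unfolding D_def using is_hom_eval[OF is_hom_id, of Y]
    by (intro is_subring_image is_subring_coeffs sub) simp
  have CD: "c \<in> D" if "c \<in> C" for c
  proof -
    have "coeff [:c:] i \<in> C" for i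
      using that is_subring_0[OF sub] by (cases i) auto
    then show ?thesis using DI[of "[:c:]"] by simp
  qed
  have YD: "Y \<in> D"
  proof -
    have "coeff [:0, 1:] i \<in> C" for i
      using is_subring_0[OF sub] is_subringD(1)[OF sub] by (auto simp: coeff_pCons split: nat.splits)
    then show ?thesis using DI[of "[:0, 1:]"] by simp
  qed
  have subE: "is_subring (sat (C2 a) D)"
    by (intro is_subring_sat subD CD C2C)
  \<comment> \<open>After multiplication by \<open>a\<close>, \<open>X\<close> is a polynomial in
    \<open>Y\<close> over \<open>C\<close>; hence each polynomial in \<open>X\<close> and
    \<open>Y\<close> is one after multiplication by a power of \<open>a\<close>.\<close>
  have "C2 a * X = f - evC \<theta> Y" by (simp add: f_eq)
  also have "\<dots> \<in> D"
    using subD CD gens C2C YD by (intro subring_intros subring_eval) auto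
  finally have "C2 a ^ 1 * X \<in> sat (C2 a) D" using sat_superset by auto
  then have "X \<in> sat (C2 a) D" by (rule sat_cancel)
  moreover have "Y \<in> sat (C2 a) D" "C2 c \<in> sat (C2 a) D" for c
    using YD CD C2C sat_superset by blast+
  ultimately have "ev2 C2 u X Y \<in> sat (C2 a) D"
    using subE by (intro subring_ev2) auto
  then obtain N Q0 where Q0: "\<And>i. coeff Q0 i \<in> C" "C2 a ^ N * u = poly Q0 Y"
    unfolding X_def Y_def ev2_C2_id by (auto simp: sat_def D_def Y_def)
  then obtain Q where Q: "\<And>i. coeff Q i \<in> C" "degree Q < p" "poly Q Y = C2 a ^ N * u"
    using reduce_degree[OF sub C2C FC gens(2), of Q0] by metis
  define v where "v = C2 a ^ N * u"
  have "\<phi> v = v" unfolding v_def \<phi>_hom \<phi>_C2 u ..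
  have \<phi>Q: "\<phi> (poly Q z) = poly Q (\<phi> z)" for z
  proof -
    have "map_poly \<phi> Q = Q"
      by (rule map_poly_idI) (use Q(1) fixC in \<open>auto simp: coeffs_def split: if_splits\<close>)
    then show ?thesis
      using hom_eval[OF is_hom_\<phi> is_hom_id, of Q z] by simp
  qed
  have shifts: "poly Q (Y + of_nat i * (C2 a * F)) = v" for i
  proof (induction i)
    case 0
    then show ?case using Q(3) by (simp add: v_def)
  next
    case (Suc i)
    have "\<phi> (of_nat i) = of_nat i" by (induction i) (simp_all add: \<phi>_hom)
    then have "\<phi> (Y + of_nat i * (C2 a * F)) = Y + of_nat (Suc i) * (C2 a * F)"
      by (simp add: \<phi>_hom \<phi>_Y \<phi>_C2 \<phi>_F algebra_simps)
    then show ?case using \<phi>Q Suc \<open>\<phi> v = v\<close> by metis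
  qed
  let ?s = "\<lambda>i. Y + of_nat i * (C2 a * F)"
  \<comment> \<open>\<open>a F\<close> is nonzero and the indices lie below the characteristic, so
    the \<open>p\<close> shifts are distinct points; their number exceeds the degree of
    \<open>Q\<close>.\<close>
  have "inj_on ?s {..<p}"
  proof (rule inj_onI)
    fix i j assume ij: "i \<in> {..<p}" "j \<in> {..<p}" "?s i = ?s j"
    then have "(of_nat i :: 'a poly poly) = of_nat j"
      using C2_nz F_nz by simp
    then show "i = j"
      using ij inj_onD[OF inj_on_of_nat_CHAR[where 'a = "'a poly poly"], of i j] char by simp
  qed
  then have "card (?s ` {..<p}) = p" by (simp add: card_image)
  then have "Q = [:v:]"
    using Q(2) ppos by (intro poly_eqI_degree[where A = "?s ` {..<p}"]) (auto simp: shifts)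
  then have "v \<in> C" using Q(1)[of 0] by simp
  then show ?thesis unfolding sat_def v_def C_def by blast
qed

end

section \<open>The comaximal case and the third invariant \<open>q2\<close>\<close>

lemma cancel_unit:
  assumes "is_subring S" "\<And>c. C2 c \<in> S" "n dvd 1" "C2 n * u \<in> S"
  shows "u \<in> S"
proof -
  obtain n' where n': "1 = n * n'" using assms(3) by (rule dvdE)
  have "C2 n' * (C2 n * u) = C2 (n * n') * u"
    by (simp only: C2_hom mult_ac)
  also have "\<dots> = u" unfolding n'[symmetric] by (simp add: C2_hom)
  finally show ?thesis using is_subringD(3)[OF assms(1,2,4), of n'] by simp
qed

lemma cong_diff_mult:
  fixes m :: "'a::comm_ring_1"
  assumes "m dvd u - g" "m dvd v - h"
  shows "m dvd (u - v) - (g - h)" "m dvd u * v - g * h"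
proof -
  have "(u - v) - (g - h) = (u - g) - (v - h)" by simp
  then show "m dvd (u - v) - (g - h)" using dvd_diff[OF assms] by metis
  have "u * v - g * h = (u - g) * v + g * (v - h)" by (simp add: algebra_simps)
  then show "m dvd u * v - g * h" using assms by auto
qed

text \<open>\<open>comaximal\<close> is the form in which principality of the ideal enters, after
  cancelling \<open>d\<close>. \<open>\<rho>p\<close> is the Frobenius twist of
  \<open>\<rho>\<close>.\<close>

locale comaximal_case = order_p_automorphism p a b d \<theta> \<rho> \<theta>s G X Y f F q q1 \<phi>x \<phi>
  for p :: nat and a b d :: "'a::{factorial_semiring, idom_divide}"
    and \<theta> \<rho> \<theta>s G X Y f F q q1 \<phi>x \<phi> +
  fixes \<rho>p r s :: "'a poly" and lam \<nu> :: "'a poly poly"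
  assumes \<rho>p_power: "pcompose \<rho>p (monom 1 p) = \<rho> ^ p"
    and \<rho>p_deriv: "pcompose (pderiv \<rho>p) (monom 1 p) = pderiv \<rho> ^ p"
    and coeff_\<rho>: "\<And>i. p dvd i \<Longrightarrow> coeff \<rho> i = 0"
    and coeff_\<rho>p: "\<And>i. coeff \<rho>p i = coeff \<rho> i ^ p"
    and lam: "pderiv \<rho> ^ p * [:0, 1:] = ev2 (\<lambda>c. [:c:]) lam ([:0, 1:] ^ p) \<rho>"
    and \<nu>: "(C2 d * F) ^ (p - 1) = ev2 C2 \<nu> q q1"
    and comaximal: "[:b:] * r + pderiv \<rho> * s = 1"
begin

text \<open>The negative of the part of \<open>\<Lambda>\<close> free of \<open>y2\<close>, taken at
  \<open>(q, q1)\<close>; thus \<open>q2\<close> is the solution \<open>y2\<close> of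
  \<open>\<Lambda>(q, q1, y2) = 0\<close>.\<close>

definition q2_num :: "'a poly poly" where
  "q2_num = q1 ^ p - evC \<rho>p q - C2 (b ^ (p - 1)) * ev2 C2 lam q q1 * ev2 C2 \<nu> q q1"

definition q2 :: "'a poly poly" where "q2 = q2_num div C2 (b ^ p)"

lemma lam_at_Y: "evC (pderiv \<rho>) Y ^ p * Y = ev2 C2 lam (Y ^ p) (evC \<rho> Y)"
proof -
  have "evC (pderiv \<rho> ^ p * [:0, 1:]) Y = ev2 (\<lambda>c. evC [:c:] Y) lam (evC ([:0, 1:] ^ p) Y) (evC \<rho> Y)"
    unfolding lam by (intro hom_ev2[OF is_hom_eval[OF is_hom_C2] is_hom_const])
  then show ?thesis
    by (simp only: evC_hom eval_var[OF is_hom_C2] eval_const[OF is_hom_C2])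
qed

text \<open>Expanding \<open>q1 = \<rho>(Y) + b (X + v)\<close> and \<open>q = Y ^ p - b ^ (p - 1) k Y\<close> to first order: the
  terms of order \<open>b ^ (p - 1)\<close> cancel by the choice of \<open>lam\<close>.\<close>

lemma q2_form:
  assumes V: "is_subring V" "\<And>c. C2 c \<in> V" "Y \<in> V" "F \<in> V"
  shows "\<exists>v0\<in>V. \<exists>v1\<in>V. \<exists>w. C2 (b ^ p) * (X ^ p + v1 * X + v0 + C2 b * w) = q2_num"
proof -
  define \<beta> where "\<beta> = C2 b"
  define \<kappa> where "\<kappa> = (C2 d * F) ^ (p - 1)"
  define R where "R = evC \<rho> Y"
  define \<delta> where "\<delta> = \<beta> ^ (p - 1) * \<kappa> * Y"
  define e where "e = \<beta> ^ (p - 2)"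
  have \<delta>q: "q = Y ^ p - \<delta>"
    by (simp add: q_eq \<delta>_def \<kappa>_def \<beta>_def C2_a power_mult_distrib mult_ac)
  have in_V: "\<beta> \<in> V" "\<kappa> \<in> V" "R \<in> V" "\<delta> \<in> V" "e \<in> V" "Y ^ p \<in> V"
    unfolding \<beta>_def \<kappa>_def R_def \<delta>_def e_def using V
    by (auto intro!: subring_intros subring_eval)
  then have qV: "q \<in> V" unfolding \<delta>q using V by (intro subring_intros)
  obtain v where v: "v \<in> V" "q1 = R + \<beta> * (X + v)"
    using q1_form'[OF V] unfolding R_def \<beta>_def by blast
  obtain w2 where w2: "w2 \<in> V" "evC \<rho>p (Y ^ p + (- \<delta>))
      = evC \<rho>p (Y ^ p) + (- \<delta>) * evC (pderiv \<rho>p) (Y ^ p) + (- \<delta>)\<^sup>2 * w2"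
    using eval_taylor2[OF V(1) is_hom_C2 V(2), of "Y ^ p" "- \<delta>" \<rho>p] in_V V
    by (auto intro: subring_intros)
  have monom_Y: "evC (monom 1 p) Y = Y ^ p"
    by (simp add: eval_monom C2_hom)
  have "evC \<rho>p (Y ^ p) = R ^ p"
    using arg_cong[OF \<rho>p_power, of "\<lambda>P. evC P Y"]
    unfolding evC_hom eval_pcompose[OF is_hom_C2] monom_Y R_def .
  moreover have "evC (pderiv \<rho>p) (Y ^ p) = evC (pderiv \<rho>) Y ^ p"
    using arg_cong[OF \<rho>p_deriv, of "\<lambda>P. evC P Y"]
    unfolding evC_hom eval_pcompose[OF is_hom_C2] monom_Y .
  \<comment> \<open>The linear Taylor term is
    \<open>\<delta> \<rho>'(Y)^p = b^(p-1) \<kappa> \<rho>'(Y)^p Y\<close>, and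
    \<open>lam_at_Y\<close> rewrites \<open>\<rho>'(Y)^p Y\<close> as a value of
    \<open>lam\<close>.\<close>
  ultimately have \<rho>p_q: "evC \<rho>p q
      = R ^ p - \<beta> ^ (p - 1) * \<kappa> * ev2 C2 lam (Y ^ p) R + \<delta>\<^sup>2 * w2"
    using w2(2) unfolding \<delta>q R_def lam_at_Y[symmetric] by (simp add: \<delta>_def mult_ac)
  obtain w3 where w3: "w3 \<in> V" "ev2 C2 lam (Y ^ p) R - ev2 C2 lam q R = (Y ^ p - q) * w3"
    using ev2_diff_factor_outer[OF V(1) is_hom_C2 V(2) in_V(6) qV in_V(3)] by blast
  obtain l where l: "l \<in> V"
    "\<And>z. \<exists>w. ev2 C2 lam q (R + z) = ev2 C2 lam q R + z * l + z\<^sup>2 * w"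
    using ev2_taylor2_inner[OF V(1) is_hom_C2 V(2) qV in_V(3)] by blast
  obtain w4 where w4: "ev2 C2 lam q q1
      = ev2 C2 lam q R + \<beta> * (X + v) * l + (\<beta> * (X + v))\<^sup>2 * w4"
    using l(2) unfolding v(2) by blast
  have lam_q: "ev2 C2 lam q q1
      = ev2 C2 lam (Y ^ p) R - \<delta> * w3 + \<beta> * (X + v) * l + (\<beta> * (X + v))\<^sup>2 * w4"
    using w3(2) w4 by (simp add: \<delta>q eq_diff_eq diff_eq_eq add.commute)
  obtain n where n: "p = n + 2"
    using p_ge_2 by (metis le_add_diff_inverse2)
  define \<Lambda>0 where "\<Lambda>0 = ev2 C2 lam (Y ^ p) R"
  \<comment> \<open>\<open>v0\<close> and \<open>v1\<close> collect the remaining terms of order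
    \<open>\<beta>^p\<close> that are free of \<open>X\<close> and linear in \<open>X\<close>. Terms
    with \<open>\<beta>^(2p-2)\<close> count as \<open>\<beta>^p e\<close>. The quadratic remainder
    of \<open>lam\<close> has order \<open>\<beta>^(p+1)\<close>, so \<open>w\<close> may contain
    \<open>X\<close> arbitrarily.\<close>
  define v0 where "v0 = v ^ p - e * \<kappa>\<^sup>2 * Y\<^sup>2 * w2 + e * \<kappa>\<^sup>2 * Y * w3 - \<kappa> * v * l"
  define v1 where "v1 = - \<kappa> * l"
  define w where "w = - \<kappa> * (X + v)\<^sup>2 * w4"
  have \<beta>p: "\<beta> ^ (p - 1) = \<beta> * e" "\<beta> ^ p = \<beta> * \<beta> * e"
    by (simp_all add: e_def n)
  have q1p: "q1 ^ p = R ^ p + \<beta> ^ p * (X ^ p + v ^ p)"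
    unfolding v(2) frobenius power_mult_distrib ..
  have "q2_num = R ^ p + \<beta> ^ p * (X ^ p + v ^ p)
      - (R ^ p - \<beta> ^ (p - 1) * \<kappa> * \<Lambda>0 + \<delta>\<^sup>2 * w2)
      - \<beta> ^ (p - 1) * (\<Lambda>0 - \<delta> * w3 + \<beta> * (X + v) * l + (\<beta> * (X + v))\<^sup>2 * w4) * \<kappa>"
    unfolding q2_num_def \<rho>p_q lam_q q1p \<nu>[symmetric] \<kappa>_def[symmetric] \<Lambda>0_def[symmetric]
    by (simp add: \<beta>_def C2_hom)
  also have "\<dots> = \<beta> ^ p * (X ^ p + v1 * X + v0 + \<beta> * w)"
    unfolding v0_def v1_def w_def \<delta>_def \<beta>p by (simp add: algebra_simps power2_eq_square)
  finally have "C2 (b ^ p) * (X ^ p + v1 * X + v0 + C2 b * w) = q2_num"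
    by (simp add: \<beta>_def C2_hom)
  moreover have "v0 \<in> V" "v1 \<in> V"
    unfolding v0_def v1_def using V in_V v w2 w3 l by (blast intro!: subring_intros)+
  ultimately show ?thesis by blast
qed

lemma C2_bp_nz: "C2 (b ^ p) \<noteq> 0"
  using C2_nz by (simp add: C2_hom)

lemma q2_eq: "C2 (b ^ p) * q2 = q2_num"
proof -
  have "C2 (b ^ p) dvd q2_num"
    using q2_form[OF is_subring_UNIV] by (metis UNIV_I dvd_triv_left)
  then show ?thesis unfolding q2_def by simp
qed

lemma q2_form':
  assumes V: "is_subring V" "\<And>c. C2 c \<in> V" "Y \<in> V" "F \<in> V"
  shows "\<exists>v0\<in>V. \<exists>v1\<in>V. \<exists>w. q2 = X ^ p + v1 * X + v0 + C2 b * w"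
  using q2_form[OF V] C2_bp_nz unfolding q2_eq[symmetric] mult_cancel_left by metis

lemma \<phi>_q2: "\<phi> q2 = q2"
proof -
  have "C2 (b ^ p) * \<phi> q2 = \<phi> (C2 (b ^ p) * q2)" by (simp only: \<phi>_hom \<phi>_C2)
  also have "\<dots> = C2 (b ^ p) * q2"
    unfolding q2_eq q2_num_def \<phi>_hom \<phi>_evC \<phi>_ev2 \<phi>_C2 \<phi>_q \<phi>_q1 ..
  finally show ?thesis using C2_bp_nz by simp
qed

text \<open>The preimage in \<open>R[x,y]\<close> of the subring \<open>(R/\<pi>)[y]\<close>; it
  tracks which parts of \<open>q1\<close> and \<open>q2\<close> are free of \<open>x\<close> modulo
  \<open>\<pi>\<close>.\<close>

definition y_like :: "'a \<Rightarrow> 'a poly poly set" where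
  "y_like \<pi> = {u. \<exists>g. C2 \<pi> dvd u - [:g:]}"

text \<open>As \<open>\<pi>\<close> divides \<open>a\<close>, the summand \<open>a x\<close> of
  \<open>f\<close> vanishes modulo \<open>\<pi>\<close>, so \<open>f\<close> and
  \<open>F = G(f)\<close> are polynomials in \<open>y\<close> alone there.\<close>

lemma y_like_mem:
  assumes "\<pi> dvd a"
  shows "is_subring (y_like \<pi>)" "C2 c \<in> y_like \<pi>" "Y \<in> y_like \<pi>" "F \<in> y_like \<pi>"
proof -
  have "u - v \<in> y_like \<pi> \<and> u * v \<in> y_like \<pi>" if uv: "u \<in> y_like \<pi>" "v \<in> y_like \<pi>" for u v
  proof -
    obtain g h where "C2 \<pi> dvd u - [:g:]" "C2 \<pi> dvd v - [:h:]"
      using uv by (auto simp: y_like_def)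
    then have "C2 \<pi> dvd (u - v) - ([:g:] - [:h:])" "C2 \<pi> dvd u * v - [:g:] * [:h:]"
      by (fact cong_diff_mult)+
    then have "C2 \<pi> dvd (u - v) - [:g - h:]" "C2 \<pi> dvd u * v - [:g * h:]"
      by (simp_all add: mult.commute)
    then show ?thesis by (auto simp: y_like_def)
  qed
  moreover have inner: "[:g:] \<in> y_like \<pi>" for g
    unfolding y_like_def by (auto intro: exI[of _ g])
  ultimately show sub: "is_subring (y_like \<pi>)"
    unfolding is_subring_def using inner[of 1] by (auto simp: one_pCons)
  show C: "C2 c \<in> y_like \<pi>" for c by (simp add: C2_def inner)
  show Y: "Y \<in> y_like \<pi>" by (simp add: Y_def inner)
  obtain k where "a = \<pi> * k" using assms by (rule dvdE)
  then have "C2 a * X - [:0:] = C2 \<pi> * (C2 k * X)" by (simp add: C2_hom)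
  then have "C2 \<pi> dvd C2 a * X - [:0:]" by (rule dvdI)
  then have "C2 a * X \<in> y_like \<pi>" unfolding y_like_def by blast
  then have "f \<in> y_like \<pi>"
    unfolding f_eq by (rule is_subring_add[OF sub _ subring_eval[OF sub is_hom_C2 C Y]])
  then show "F \<in> y_like \<pi>"
    unfolding F_eq using sub C by (intro subring_eval) auto
qed

text \<open>Modulo \<open>\<pi>\<close> the comaximality relation reads
  \<open>\<rho>' s = 1\<close>, so \<open>\<rho>'\<close> is constant there. This kills
  \<open>i\<close> times the coefficient, and \<open>i\<close> is invertible unless \<open>p\<close>
  divides it, when the coefficient is zero anyway.\<close>

lemma coeff_\<rho>_dvd:
  assumes "prime \<pi>" "\<pi> dvd b" "i \<ge> 2"
  shows "\<pi> dvd coeff \<rho> i"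
proof (cases "p dvd i")
  case False
  obtain j where j: "i = Suc j" "j > 0" using assms(3) by (cases i) auto
  have "pderiv \<rho> * s - 1 = [:b:] * (- r)"
    using comaximal by (simp add: algebra_simps)
  moreover have "[:\<pi>:] dvd [:b:]" using assms(2) by simp
  ultimately have "[:\<pi>:] dvd pderiv \<rho> * s - 1" by (metis dvd_mult2)
  then have "\<pi> dvd of_nat i * coeff \<rho> i"
    using unit_mod_prime_const[of \<pi> "pderiv \<rho>" s j] assms(1) j by (simp add: coeff_pderiv)
  moreover obtain m where "of_nat m * of_nat i = (1 :: 'a)"
    using of_nat_invertible_mod_CHAR[OF char ppos False] by blast
  then have "coeff \<rho> i = of_nat m * (of_nat i * coeff \<rho> i)"
    by (simp flip: mult.assoc)
  ultimately show ?thesis by (metis dvd_mult)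
qed (simp add: coeff_\<rho>)

lemma comaximal_0: "b * coeff r 0 + coeff \<rho> 1 * coeff s 0 = 1"
  using arg_cong[OF comaximal, of "\<lambda>P. coeff P 0"]
  by (simp add: coeff_mult_0 coeff_pderiv)

lemma coeff_\<rho>_1_not_dvd:
  assumes "prime \<pi>" "\<pi> dvd b"
  shows "\<not> \<pi> dvd coeff \<rho> 1"
proof
  assume "\<pi> dvd coeff \<rho> 1"
  then have "\<pi> dvd 1"
    using assms(2) unfolding comaximal_0[symmetric] by (intro dvd_add dvd_mult2)
  then show False using assms(1) by (metis not_prime_unit)
qed

section \<open>Saturation at the primes dividing \<open>a\<close>, and the invariant ring\<close>

definition B :: "'a poly poly set" where "B = range (\<lambda>P. ev3 C2 P q q1 q2)"

lemma B_mem: "is_subring B" "C2 c \<in> B" "q \<in> B" "q1 \<in> B" "q2 \<in> B"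
proof -
  show "is_subring B"
    unfolding B_def by (intro is_subring_range is_hom_ev3 is_hom_C2)
  show "C2 c \<in> B" for c
    unfolding B_def by (rule range_eqI[of _ _ "C3 c"]) (simp add: ev3_C3)
  have "q = ev3 C2 [:0, 1:] q q1 q2" "q1 = ev3 C2 [:[:0, 1:]:] q q1 q2"
    "q2 = ev3 C2 [:[:[:0, 1:]:]:] q q1 q2"
    by (simp_all add: ev3_y0 ev3_y1 ev3_y2)
  then show "q \<in> B" "q1 \<in> B" "q2 \<in> B"
    unfolding B_def by (metis rangeI)+
qed

lemma B_fixed: "u \<in> B \<Longrightarrow> \<phi> u = u"
proof -
  assume "u \<in> B"
  then obtain P where "u = ev3 C2 P q q1 q2" unfolding B_def by blast
  then show ?thesis
    using subring_ev3[OF is_subring_fixed is_hom_C2, of q q1 q2 P] by (simp add: \<phi>_C2 \<phi>_q \<phi>_q1 \<phi>_q2)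
qed

text \<open>\<open>q1\<close> takes the outer variable because it is the generator of positive
  \<open>x\<close>-degree modulo a prime not dividing \<open>b\<close>.\<close>

definition B1 :: "'a poly poly set" where "B1 = range (\<lambda>P. ev2 C2 P q1 q)"

lemma B1_mem: "is_subring B1" "C2 c \<in> B1" "q \<in> B1" "q1 \<in> B1"
proof -
  show "is_subring B1"
    unfolding B1_def by (intro is_subring_range is_hom_ev2 is_hom_C2)
  show "C2 c \<in> B1" for c
    unfolding B1_def by (rule range_eqI[of _ _ "C2 c"]) (simp add: ev2_C2)
  have "q1 = ev2 C2 [:0, 1:] q1 q" "q = ev2 C2 [:[:0, 1:]:] q1 q"
    by (simp_all add: ev2_x ev2_y)
  then show "q \<in> B1" "q1 \<in> B1"
    unfolding B1_def by (metis rangeI)+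
qed

lemma B1_subset: "B1 \<subseteq> B"
  unfolding B1_def using B_mem by (auto intro!: subring_ev2)

text \<open>Modulo \<open>\<pi>\<close>, \<open>q\<close> is \<open>y^p\<close> and
  \<open>q1\<close> is \<open>b x + g(y)\<close> with \<open>b\<close> nonzero. These are
  algebraically independent, so a polynomial in them divisible by \<open>\<pi>\<close> has all its
  coefficients divisible by \<open>\<pi>\<close>.\<close>

lemma B1_saturated:
  assumes \<pi>: "prime \<pi>" "\<pi> dvd a" "\<not> \<pi> dvd b" and w: "C2 \<pi> * w \<in> B1"
  shows "w \<in> B1"
proof -
  obtain P where P: "C2 \<pi> * w = ev2 C2 P q1 q" using w unfolding B1_def by blast
  note V = y_like_mem[OF \<pi>(2)]
  obtain v where v: "v \<in> y_like \<pi>" "q1 = evC \<rho> Y + C2 b * (X + v)"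
    using q1_form'[OF V] by blast
  have "evC \<rho> Y + C2 b * v \<in> y_like \<pi>"
    using V v by (intro subring_intros subring_eval) auto
  then obtain g where "C2 \<pi> dvd evC \<rho> Y + C2 b * v - [:g:]"
    by (auto simp: y_like_def)
  moreover have "q1 - [:g, [:b:]:] = evC \<rho> Y + C2 b * v - [:g:]"
    unfolding v(2) X_def by (simp add: C2_def algebra_simps)
  ultimately have g: "C2 \<pi> dvd q1 - [:g, [:b:]:]" by simp
  have "C2 \<pi> dvd C2 a" using \<pi>(2) by (simp add: C2_def)
  moreover have "p - 1 \<noteq> 0" using p_ge_2 by simp
  ultimately have "C2 \<pi> dvd (C2 a * F) ^ (p - 1)"
    by (meson dvd_mult2 dvd_power dvd_trans neq0_conv)
  then have q: "C2 \<pi> dvd q - [:monom 1 p:]"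
  proof -
    have "[:monom 1 p:] = Y ^ p"
      using evC_Y[of "monom 1 p :: 'a poly"] eval_monom[OF is_hom_C2, of 1 p Y]
      unfolding Y_def[symmetric] C2_hom by simp
    then have "q - [:monom 1 p:] = (C2 a * F) ^ (p - 1) * - Y" by (simp add: q_eq)
    then show ?thesis using \<open>C2 \<pi> dvd (C2 a * F) ^ (p - 1)\<close> by (metis dvd_mult2)
  qed
  have "C2 \<pi> dvd P"
  proof (rule prime_dvd_ev2[OF _ q _ _ g])
    show "is_top \<pi> (monom 1 p) p" "is_top [:\<pi>:] [:g, [:b:]:] 1"
      using \<pi> by (auto simp: is_top_def coeff_pCons split: nat.splits)
    show "C2 \<pi> dvd ev2 C2 P q1 q" unfolding P[symmetric] by simp
  qed (use \<pi> ppos in auto)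
  then obtain P' where "P = C2 \<pi> * P'" by (rule dvdE)
  then have "C2 \<pi> * w = C2 \<pi> * ev2 C2 P' q1 q"
    using P by (simp only: hom_simps[OF is_hom_ev2[OF is_hom_C2]] ev2_C2 is_hom_C2)
  moreover have "C2 \<pi> \<noteq> 0" using \<pi> by (auto simp: C2_def)
  ultimately have "w = ev2 C2 P' q1 q" by (simp only: mult_cancel_left simp_thms)
  then show ?thesis unfolding B1_def by blast
qed

text \<open>Modulo \<open>\<pi>\<close> the relation defining \<open>q2\<close> becomes
  \<open>t^p q = q1^p\<close> with \<open>t\<close> a unit, so \<open>q\<close> can be eliminated.
  Independence of \<open>q1\<close> and \<open>q2\<close> modulo \<open>\<pi>\<close> then finishes
  the argument.\<close>

lemma B_saturated:
  assumes \<pi>: "prime \<pi>" "\<pi> dvd b" and w: "C2 \<pi> * w \<in> B"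
  shows "w \<in> B"
proof -
  have \<pi>a: "\<pi> dvd a" using \<pi>(2) a_eq by simp
  note V = y_like_mem[OF \<pi>a]
  have C\<pi>b: "C2 \<pi> dvd C2 b" using \<pi>(2) by (simp add: C2_def)
  \<comment> \<open>\<open>S = R[q1, q2] + \<pi> B\<close>; the first goal is
    \<open>B \<subseteq> S\<close>, for which only \<open>q \<in> S\<close> needs an
    argument.\<close>
  define S where "S = {u. \<exists>P. \<exists>z\<in>B. u = ev2 C2 P q2 q1 + C2 \<pi> * z}"
  note ev2_hom = hom_simps[OF is_hom_ev2[OF is_hom_C2]]
  have E_B: "ev2 C2 P q2 q1 \<in> B" for P
    using B_mem by (intro subring_ev2) auto
  have E_S: "ev2 C2 P q2 q1 \<in> S" for P
    unfolding S_def using is_subring_0[OF B_mem(1)] by force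
  have B_S: "C2 \<pi> * z \<in> S" if "z \<in> B" for z
    unfolding S_def using that by (auto intro!: exI[of _ 0] simp: ev2_hom)
  have "u - v \<in> S \<and> u * v \<in> S" if uv: "u \<in> S" "v \<in> S" for u v
  proof -
    obtain P Q y z where *: "y \<in> B" "z \<in> B" "u = ev2 C2 P q2 q1 + C2 \<pi> * y"
        "v = ev2 C2 Q q2 q1 + C2 \<pi> * z"
      using uv unfolding S_def by blast
    have "u - v = ev2 C2 (P - Q) q2 q1 + C2 \<pi> * (y - z)"
      "u * v = ev2 C2 (P * Q) q2 q1 + C2 \<pi> * (ev2 C2 P q2 q1 * z + y * ev2 C2 Q q2 q1 + C2 \<pi> * (y * z))"
      by (simp_all add: * ev2_hom algebra_simps)
    moreover have "y - z \<in> B"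
      "ev2 C2 P q2 q1 * z + y * ev2 C2 Q q2 q1 + C2 \<pi> * (y * z) \<in> B"
      using B_mem * E_B by (auto intro!: subring_intros)
    ultimately show ?thesis unfolding S_def by blast
  qed
  moreover have "1 \<in> S" using E_S[of 1] by (simp add: ev2_hom)
  ultimately have S: "is_subring S" by (simp add: is_subring_def)
  have C2S: "C2 c \<in> S" for c using E_S[of "C2 c"] by (simp add: ev2_C2)
  have gens: "q2 \<in> S" "q1 \<in> S"
    using E_S[of "[:0, 1:]"] E_S[of "[:[:0, 1:]:]"] by (simp_all add: ev2_x ev2_y)
  define t e where "t = coeff \<rho> 1" and "e = coeff s 0"
  have "[:\<pi>:] dvd \<rho>p - [:0, t ^ p:]"
  proof -
    have "\<pi> dvd coeff (\<rho>p - [:0, t ^ p:]) i" for i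
    proof -
      consider "i = 0" | "i = 1" | "i \<ge> 2" by linarith
      then show ?thesis
      proof cases
        case 3
        then have "\<pi> dvd coeff \<rho> i" by (intro coeff_\<rho>_dvd \<pi>)
        then have "\<pi> dvd coeff \<rho> i ^ p" using ppos by (simp add: dvd_power_iff dvd_trans[OF _ dvd_power])
        then show ?thesis using 3 by (auto simp: coeff_\<rho>p coeff_pCons split: nat.splits)
      qed (use ppos in \<open>auto simp: power_0_left coeff_\<rho>p coeff_\<rho> t_def\<close>)
    qed
    then show ?thesis by (simp add: const_poly_dvd_iff)
  qed
  then obtain \<sigma> where "\<rho>p - [:0, t ^ p:] = [:\<pi>:] * \<sigma>" by (rule dvdE)
  then have "\<rho>p = [:t ^ p:] * [:0, 1:] + [:\<pi>:] * \<sigma>" by (simp add: algebra_simps)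
  then have \<rho>p_q: "evC \<rho>p q = C2 (t ^ p) * q + C2 \<pi> * evC \<sigma> q"
    by (simp only: evC_hom eval_var[OF is_hom_C2] eval_const[OF is_hom_C2])
  have \<sigma>B: "evC \<sigma> q \<in> B" "ev2 C2 lam q q1 \<in> B" "ev2 C2 \<nu> q q1 \<in> B"
    using B_mem by (auto intro!: subring_eval subring_ev2)
  obtain k where k: "b = \<pi> * k" using \<pi>(2) by (rule dvdE)
  obtain n where n: "p = n + 2"
    using p_ge_2 by (metis le_add_diff_inverse2)
  \<comment> \<open>\<open>e\<close> inverts \<open>t\<close> modulo \<open>\<pi>\<close>; Frobenius
    turns this into an inverse of \<open>t^p\<close>.\<close>
  have "C2 e * C2 t = 1 - C2 \<pi> * C2 (k * coeff r 0)"
    using arg_cong[OF comaximal_0, of C2] unfolding C2_hom t_def e_def k by (simp add: algebra_simps)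
  then have "(C2 e * C2 t) ^ p = (1 + C2 \<pi> * - C2 (k * coeff r 0)) ^ p" by simp
  also have "\<dots> = 1 + C2 \<pi> * (C2 \<pi> ^ (p - 1) * (- C2 (k * coeff r 0)) ^ p)"
    unfolding frobenius power_mult_distrib using power_eq_if[of "C2 \<pi>" p] ppos by simp
  finally have te_p: "(C2 e * C2 t) ^ p = 1 + C2 \<pi> * (C2 \<pi> ^ (p - 1) * (- C2 (k * coeff r 0)) ^ p)" .
  \<comment> \<open>The relation defining \<open>q2\<close> is solved for \<open>t^p q\<close>.
    Apart from \<open>q1^p\<close>, each term has a factor \<open>b = \<pi> k\<close> or an explicit
    factor \<open>\<pi>\<close>; \<open>p \<ge> 2\<close> ensures this for
    \<open>b^(p-1)\<close>.\<close>
  have "C2 (t ^ p) * q = q1 ^ p - C2 (b ^ (p - 1)) * ev2 C2 lam q q1 * ev2 C2 \<nu> q q1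
      - C2 (b ^ p) * q2 - C2 \<pi> * evC \<sigma> q"
    using q2_eq unfolding q2_num_def \<rho>p_q by (simp add: algebra_simps)
  also have "\<dots> = q1 ^ p + C2 \<pi> * (- C2 k * C2 b ^ n * ev2 C2 lam q q1 * ev2 C2 \<nu> q q1
      - C2 k * C2 b ^ (n + 1) * q2 - evC \<sigma> q)"
    by (simp add: n C2_hom k algebra_simps power_mult_distrib)
  finally have tq: "C2 (t ^ p) * q = \<dots>" .
  have "- C2 k * C2 b ^ n * ev2 C2 lam q q1 * ev2 C2 \<nu> q q1
      - C2 k * C2 b ^ (n + 1) * q2 - evC \<sigma> q \<in> B"
    using B_mem \<sigma>B by (blast intro!: subring_intros)
  then have "C2 (t ^ p) * q \<in> S"
    unfolding tq by (rule is_subring_add[OF S is_subring_power[OF S gens(2)] B_S])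
  then have "C2 (e ^ p) * (C2 (t ^ p) * q) \<in> S"
    by (rule is_subringD(3)[OF S C2S])
  moreover have "C2 (e ^ p) * (C2 (t ^ p) * q)
      = q + C2 \<pi> * ((C2 \<pi> ^ (p - 1) * (- C2 (k * coeff r 0)) ^ p) * q)"
    using arg_cong[OF te_p, of "\<lambda>z. z * q"] by (simp add: C2_hom algebra_simps power_mult_distrib)
  moreover have "(C2 \<pi> ^ (p - 1) * (- C2 (k * coeff r 0)) ^ p) * q \<in> B"
    using B_mem by (blast intro!: subring_intros)
  ultimately have "q \<in> S"
    using B_S is_subringD(2)[OF S] by (metis add_diff_cancel_right')
  then have "B \<subseteq> S"
    unfolding B_def using S C2S gens by (auto intro!: subring_ev3)
  then obtain P z where Pz: "z \<in> B" "C2 \<pi> * w = ev2 C2 P q2 q1 + C2 \<pi> * z"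
    using w unfolding S_def by blast
  then have "ev2 C2 P q2 q1 = C2 \<pi> * (w - z)" by (simp add: algebra_simps)
  then have P: "C2 \<pi> dvd ev2 C2 P q2 q1" by simp
  obtain v where "q1 = evC \<rho> Y + C2 b * (X + v)"
    using q1_form'[OF V] by blast
  then have u: "C2 \<pi> dvd q1 - [:\<rho>:]"
    using C\<pi>b by (simp add: evC_Y Y_def)
  obtain v0 v1 z' where v: "v0 \<in> y_like \<pi>" "v1 \<in> y_like \<pi>" "q2 = X ^ p + v1 * X + v0 + C2 b * z'"
    using q2_form'[OF V] by blast
  then obtain g0 g1 where g: "C2 \<pi> dvd v0 - [:g0:]" "C2 \<pi> dvd v1 - [:g1:]"
    unfolding y_like_def by blast
  have "q2 - (X ^ p + [:g1:] * X + [:g0:]) = (v1 - [:g1:]) * X + (v0 - [:g0:]) + C2 b * z'"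
    unfolding v(3) by (simp add: algebra_simps)
  moreover have "C2 \<pi> dvd \<dots>"
    using g C\<pi>b by (intro dvd_add dvd_mult2)
  ultimately have q2: "C2 \<pi> dvd q2 - (X ^ p + [:g1:] * X + [:g0:])" by (simp only:)
  have "C2 \<pi> dvd P"
  proof (rule prime_dvd_ev2[OF _ u _ _ q2 _ _ P])
    show "is_top \<pi> \<rho> 1"
      using coeff_\<rho>_1_not_dvd[OF \<pi>] coeff_\<rho>_dvd[OF \<pi>] by (auto simp: is_top_def)
    have "X ^ p + [:g1:] * X + [:g0:] = monom 1 p + [:g0, g1:]"
      by (simp add: X_def monom_altdef)
    \<comment> \<open>\<open>p \<ge> 2\<close> places the linear part strictly below the leading
      term \<open>x^p\<close>.\<close>
    moreover have "is_top [:\<pi>:] (monom 1 p + [:g0, g1:]) p"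
      using p_ge_2 \<pi>(1) by (auto simp: is_top_def coeff_pCons one_pCons split: nat.splits)
    ultimately show "is_top [:\<pi>:] (X ^ p + [:g1:] * X + [:g0:]) p" by simp
  qed (use \<pi> ppos in auto)
  then obtain P' where "P = C2 \<pi> * P'" by (rule dvdE)
  then have "C2 \<pi> * w = C2 \<pi> * (ev2 C2 P' q2 q1 + z)"
    using Pz(2) by (simp only: ev2_hom ev2_C2 is_hom_C2 distrib_left)
  moreover have "C2 \<pi> \<noteq> 0" using \<pi> by (auto simp: C2_def)
  ultimately have "w = ev2 C2 P' q2 q1 + z" by (simp only: mult_cancel_left simp_thms)
  then show ?thesis using B_mem Pz(1) E_B by (auto intro: subring_intros)
qed

text \<open>Primes dividing \<open>b\<close> are collected in \<open>m\<close>, the others are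
  cancelled by \<open>B1_saturated\<close>. This comes before the passage from \<open>B1\<close> to
  \<open>B\<close>, since the two saturation lemmas concern different rings.\<close>

lemma remove_primes_not_dividing_b:
  assumes "n \<noteq> 0" "\<forall>\<pi>. prime \<pi> \<and> \<pi> dvd n \<longrightarrow> \<pi> dvd a" "C2 n * u \<in> B1"
  shows "\<exists>m. m \<noteq> 0 \<and> (\<forall>\<pi>. prime \<pi> \<and> \<pi> dvd m \<longrightarrow> \<pi> dvd b) \<and> C2 m * u \<in> B1"
  using assms
proof (induction n arbitrary: u rule: prime_divisors_induct)
  case (unit n)
  have "u \<in> B1" by (rule cancel_unit[OF B1_mem(1,2) unit(1,4)])
  then show ?case
    using not_prime_unit by (intro exI[of _ 1]) (auto simp: C2_hom)
next
  case (factor \<pi> n)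
  have n: "n \<noteq> 0" "\<forall>\<pi>. prime \<pi> \<and> \<pi> dvd n \<longrightarrow> \<pi> dvd a" using factor by auto
  show ?case
  proof (cases "\<pi> dvd b")
    case True
    have "C2 n * (C2 \<pi> * u) \<in> B1" using factor(5) by (simp add: C2_hom mult_ac)
    then obtain m where m: "m \<noteq> 0" "\<forall>\<pi>. prime \<pi> \<and> \<pi> dvd m \<longrightarrow> \<pi> dvd b" "C2 m * (C2 \<pi> * u) \<in> B1"
      using factor(2)[OF n, of "C2 \<pi> * u"] by blast
    have "C2 (m * \<pi>) * u \<in> B1" using m(3) by (simp add: C2_hom mult_ac)
    moreover have "\<pi>' dvd b" if "prime \<pi>'" "\<pi>' dvd m * \<pi>" for \<pi>'
      using that m(2) True by (auto simp: prime_dvd_mult_iff intro: dvd_trans)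
    ultimately show ?thesis
      using m(1) factor(1) by (intro exI[of _ "m * \<pi>"]) auto
  next
    case False
    have "C2 \<pi> * (C2 n * u) \<in> B1" using factor(5) by (simp add: C2_hom mult_ac)
    then have "C2 n * u \<in> B1"
      using factor False by (metis B1_saturated dvd_triv_left)
    then show ?thesis by (rule factor(2)[OF n])
  qed
qed auto

lemma remove_primes_dividing_b:
  assumes "m \<noteq> 0" "\<forall>\<pi>. prime \<pi> \<and> \<pi> dvd m \<longrightarrow> \<pi> dvd b" "C2 m * u \<in> B"
  shows "u \<in> B"
  using assms
proof (induction m rule: prime_divisors_induct)
  case (unit n)
  show ?case by (rule cancel_unit[OF B_mem(1,2) unit(1,4)])
next
  case (factor \<pi> n)
  have "C2 \<pi> * (C2 n * u) \<in> B" using factor(5) by (simp add: C2_hom mult_ac)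
  then have "C2 n * u \<in> B" using factor by (auto intro: B_saturated[of \<pi> "C2 n * u"])
  then show ?case using factor by auto
qed auto

text \<open>For invariant \<open>u\<close>, some \<open>a^N u\<close> lies in
  \<open>R[f, q]\<close>, hence in \<open>B1\<close> because \<open>f = d q1 + \<theta>s(q)\<close>.
  The prime factors of \<open>a^N\<close> are then removed in two rounds.\<close>

lemma fixed_eq_B: "{u. \<phi> u = u} = B"
proof (intro equalityI subsetI)
  fix u assume "u \<in> {u. \<phi> u = u}"
  then obtain N P where P: "C2 a ^ N * u = ev2 C2 P f q"
    using fixed_subset_sat[of u] unfolding sat_def by blast
  have "f = C2 d * q1 + evC \<theta>s q" by (simp add: q1_eq)
  also have "\<dots> \<in> B1" using B1_mem by (intro subring_intros subring_eval) auto
  finally have "ev2 C2 P f q \<in> B1" using B1_mem by (intro subring_ev2) auto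
  then have "C2 (a ^ N) * u \<in> B1" using P by (simp add: C2_hom)
  then obtain m where "m \<noteq> 0" "\<forall>\<pi>. prime \<pi> \<and> \<pi> dvd m \<longrightarrow> \<pi> dvd b" "C2 m * u \<in> B1"
    using remove_primes_not_dividing_b[of "a ^ N" u] a_nz prime_dvd_power by (metis power_not_zero)
  then show "u \<in> B" using remove_primes_dividing_b B1_subset by blast
qed (simp add: B_fixed)

end

section \<open>The coordinate and the invariant ring\<close>

lemma ev2_map_const:
  assumes "is_hom h"
  shows "ev2 h (map_poly (\<lambda>c. [:c:]) P) u v = poly (map_poly h P) u"
proof (rule eval_unique[where g = "\<lambda>P. ev2 h (map_poly (\<lambda>c. [:c:]) P) u v"])
  show "is_hom (\<lambda>P. ev2 h (map_poly (\<lambda>c. [:c:]) P) u v)"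
    by (rule is_hom_comp[OF is_hom_ev2[OF assms] is_hom_map_poly[OF is_hom_const]])
qed (use assms in \<open>auto simp: ev2_const ev2_pCons map_poly_pCons is_hom_1 eval_const
    is_hom_0[OF is_hom_ev2[OF assms]] is_hom_0[OF is_hom_eval[OF assms]]\<close>)

lemma ev2_swap: "ev2 C2 P u v = ev2 C2 (ev2 C2 P [:[:0, 1:]:] [:0, 1:]) v u"
  using hom_ev2[OF is_hom_ev2[OF is_hom_C2, of v u] is_hom_C2, of P "[:[:0, 1:]:]" "[:0, 1:]"]
  by (simp add: ev2_x ev2_y ev2_C2)

lemma swap_eq_0D: "ev2 C2 P [:[:0, 1:]:] [:0, 1:] = 0 \<Longrightarrow> P = 0"
  using ev2_swap[of P "[:0, 1:]" "[:[:0, 1:]:]"]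
  by (simp add: ev2_C2_id hom_simps[OF is_hom_ev2[OF is_hom_C2]])

context comaximal_case
begin

text \<open>Two injective substitutions: \<open>q\<close> has degree \<open>p\<close> in
  \<open>Y\<close> over \<open>R[f]\<close>, and \<open>f\<close> has degree \<open>1\<close> in
  \<open>x\<close> over \<open>R[y]\<close>. The variables are swapped so that each substitution
  acts on the outer one.\<close>

lemma fq_independent:
  assumes "ev2 C2 P f q = 0"
  shows "P = 0"
proof -
  note ev2_hom = hom_simps[OF is_hom_ev2[OF is_hom_C2]]
  define P' where "P' = ev2 C2 P Y X"
  \<comment> \<open>\<open>q\<close> written over \<open>R[f]\<close>: the outer variable stands for
    \<open>Y\<close>, the inner one for \<open>f\<close>.\<close>
  define qq where "qq = X ^ p - [:([:a:] * G) ^ (p - 1):] * X"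
  have "ev2 C2 [:[:a:] * G:] Y f = C2 a * F"
    by (simp only: ev2_inner is_hom_C2 evC_hom eval_const F_eq)
  then have "ev2 C2 [:([:a:] * G) ^ (p - 1):] Y f = (C2 a * F) ^ (p - 1)"
    by (simp only: ev2_hom flip: poly_const_pow)
  then have qq: "ev2 C2 qq Y f = q"
    unfolding qq_def q_eq ev2_hom by (simp only: X_def ev2_x is_hom_C2)
  have "ev2 C2 P' q f = 0"
    using assms ev2_swap[of P f q] by (simp add: P'_def X_def Y_def)
  then have "ev2 C2 (pcompose P' qq) Y f = 0"
    by (simp add: ev2_pcompose qq)
  then have "ev2 C2 (ev2 C2 (pcompose P' qq) Y X) f Y = 0"
    using ev2_swap[of "pcompose P' qq" Y f] by (simp add: X_def Y_def)
  then have "pcompose (ev2 C2 (pcompose P' qq) Y X) f = 0"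
    by (simp add: Y_def ev2_C2_const_inner)
  moreover have "f = [:\<theta>, [:a:]:]"
    unfolding f_eq X_def Y_def evC_Y by (simp add: C2_def)
  then have "degree f > 0" using a_nz by simp
  ultimately have "ev2 C2 (pcompose P' qq) Y X = 0" by (rule pcompose_eq_0)
  then have "pcompose P' qq = 0"
    unfolding X_def Y_def by (rule swap_eq_0D)
  moreover have "coeff qq p = 1"
  proof -
    have "qq = monom 1 p - [:0, ([:a:] * G) ^ (p - 1):]"
      by (simp add: qq_def X_def monom_altdef)
    then show ?thesis
      using p_ge_2 by (auto simp: coeff_pCons split: nat.splits)
  qed
  then have "degree qq > 0"
    using le_degree[of qq p] ppos by simp
  ultimately have "P' = 0" by (rule pcompose_eq_0)
  then show ?thesis
    unfolding P'_def X_def Y_def by (rule swap_eq_0D)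
qed

text \<open>\<open>\<Lambda> - b^p y2\<close>, regarded as a polynomial in \<open>y0\<close> over
  \<open>R[y1]\<close>.\<close>

definition \<Gamma> :: "'a poly poly" where
  "\<Gamma> = map_poly (\<lambda>c. [:c:]) \<rho>p - [:[:0, 1:] ^ p:] + C2 (b ^ (p - 1)) * lam * \<nu>"

lemma ev2_\<Gamma>:
  assumes "is_hom h"
  shows "ev2 h \<Gamma> u v = poly (map_poly h \<rho>p) u - v ^ p + h (b ^ (p - 1)) * ev2 h lam u v * ev2 h \<nu> u v"
  unfolding \<Gamma>_def hom_simps[OF is_hom_ev2[OF assms]] ev2_map_const[OF assms] ev2_C2[OF assms]
    ev2_inner[OF assms] hom_simps[OF is_hom_eval[OF assms]] eval_var[OF assms] ..

lemma \<Gamma>_invertible: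
  \<comment> \<open>Modulo the radical of \<open>b\<close>, \<open>\<Gamma>\<close> is the linear
    polynomial \<open>t^p y0 - y1^p\<close>, and \<open>t^p\<close> is invertible modulo
    \<open>b^p\<close>.\<close>
  "\<exists>H. [:[:b ^ p:]:] dvd pcompose \<Gamma> H - [:0, 1:] \<and> [:[:b ^ p:]:] dvd pcompose H \<Gamma> - [:0, 1:]"
proof -
  obtain r0 k where r0: "r0 dvd b" "b dvd r0 ^ k"
    "\<forall>c. (\<forall>\<pi>. prime \<pi> \<and> \<pi> dvd b \<longrightarrow> \<pi> dvd c) \<longrightarrow> r0 dvd c"
    using exists_radical[OF b_nz] by (elim exE conjE)
  define t e where "t = coeff \<rho> 1" and "e = coeff s 0"
  show ?thesis
  proof (rule pcompose_inverse_mod)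
    have "r0 dvd coeff (\<rho>p - [:0, t ^ p:]) i" for i
    proof -
      consider "i = 0" | "i = 1" | "i \<ge> 2" by linarith
      then show ?thesis
      proof cases
        case 3
        then have "r0 dvd coeff \<rho> i" using coeff_\<rho>_dvd r0(3) by blast
        then have "r0 dvd coeff \<rho> i ^ p" using ppos by (meson dvd_power dvd_trans)
        then show ?thesis using 3 by (auto simp: coeff_\<rho>p coeff_pCons split: nat.splits)
      qed (use ppos in \<open>auto simp: power_0_left coeff_\<rho>p coeff_\<rho> t_def\<close>)
    qed
    then have "[:[:r0:]:] dvd map_poly (\<lambda>c. [:c:]) (\<rho>p - [:0, t ^ p:])"
      by (simp add: const_poly_dvd_iff[of "[:r0:]"] coeff_map_poly)
    moreover have "[:[:r0:]:] dvd C2 (b ^ (p - 1)) * lam * \<nu>"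
    proof -
      have "p - 1 > 0" using p_ge_2 by simp
      then have "r0 dvd b ^ (p - 1)" using r0(1) by (meson dvd_power dvd_trans)
      then have "[:[:r0:]:] dvd C2 (b ^ (p - 1))" by (simp add: C2_def)
      then show ?thesis by (intro dvd_mult2)
    qed
    moreover have "\<Gamma> - [:- ([:0, 1:] ^ p), [:t ^ p:]:]
        = map_poly (\<lambda>c. [:c:]) (\<rho>p - [:0, t ^ p:]) + C2 (b ^ (p - 1)) * lam * \<nu>"
      unfolding \<Gamma>_def hom_simps[OF is_hom_map_poly[OF is_hom_const]]
      by (simp add: map_poly_pCons)
    ultimately show "[:[:r0:]:] dvd \<Gamma> - [:- ([:0, 1:] ^ p), [:t ^ p:]:]" by (simp only: dvd_add)
    show "[:b ^ p:] dvd [:r0:] ^ (k * p)"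
      using dvd_power_same[OF r0(2), of p] by (simp add: poly_const_pow power_mult)
    show "[:r0:] dvd [:b ^ p:]"
      using r0(1) ppos by (simp, meson dvd_power dvd_trans)
    \<comment> \<open>Invertibility of \<open>t\<close> modulo \<open>b\<close> becomes
      invertibility of \<open>t^p\<close> modulo the full \<open>b^p\<close> by taking
      \<open>p\<close>-th powers.\<close>
    have "e * t = 1 + b * - coeff r 0"
      using comaximal_0 unfolding t_def e_def by (simp add: algebra_simps)
    moreover have "(1 + b * - coeff r 0) ^ p = 1 ^ p + (b * - coeff r 0) ^ p"
      using char p_prime by (intro freshmans_dream) simp_all
    ultimately have "(e * t) ^ p = 1 + b ^ p * (- coeff r 0) ^ p"
      by (simp only: power_mult_distrib power_one)
    then have "[:e ^ p:] * [:t ^ p:] - 1 = [:b ^ p:] * [:(- coeff r 0) ^ p:]"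
      by (simp add: power_mult_distrib one_pCons mult.commute)
    then show "[:b ^ p:] dvd [:e ^ p:] * [:t ^ p:] - 1" by (rule dvdI)
  qed
qed

text \<open>Evaluation at \<open>(q, q1, q2)\<close> maps onto \<open>B\<close> and kills
  \<open>\<Lambda>\<close>. In the coordinates \<open>(y1, \<Lambda>, L)\<close> its image is
  therefore \<open>R[q1, l]\<close> with \<open>l\<close> the image of \<open>L\<close>, and it
  remains to see that \<open>q1\<close> and \<open>l\<close> are independent.\<close>

lemma coordinate_and_fixed_ring:
  fixes Y0 Y1 Y2 \<Lambda> :: "'a poly poly poly"
  defines "Y0 \<equiv> [:0, 1:]" and "Y1 \<equiv> [:[:0, 1:]:]" and "Y2 \<equiv> [:[:[:0, 1:]:]:]"
    and "\<Lambda> \<equiv> C3 b ^ p * Y2 + poly (map_poly C3 \<rho>p) Y0 - Y1 ^ p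
      + C3 (b ^ (p - 1)) * ev2 C3 lam Y0 Y1 * ev2 C3 \<nu> Y0 Y1"
  shows "\<exists>L. range (\<lambda>P. ev3 C3 P Y1 \<Lambda> L) = UNIV"
    and "\<exists>\<psi>. ralg_hom \<psi> \<and> bij_betw \<psi> UNIV {u. \<phi> u = u}"
proof -
  note ev2_hom = hom_simps[OF is_hom_ev2[OF is_hom_C2]]
  obtain H where H: "[:[:b ^ p:]:] dvd pcompose \<Gamma> H - [:0, 1:]"
      "[:[:b ^ p:]:] dvd pcompose H \<Gamma> - [:0, 1:]"
    using \<Gamma>_invertible by blast
  have \<Lambda>: "\<Lambda> = C3 (b ^ p) * Y2 + ev2 C3 \<Gamma> Y0 Y1"
    unfolding \<Lambda>_def ev2_\<Gamma>[OF is_hom_C3] by (simp add: hom_simps[OF is_hom_C3])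
  obtain L where L: "Y0 = ev2 C3 H \<Lambda> Y1 + C3 (b ^ p) * L"
      "range (\<lambda>P. ev3 C3 P Y1 \<Lambda> L) = UNIV"
    using coordinate_of_inverse[OF _ H \<Lambda>[unfolded Y0_def Y1_def Y2_def]] b_nz
    unfolding Y0_def Y1_def Y2_def by auto
  then show "\<exists>L. range (\<lambda>P. ev3 C3 P Y1 \<Lambda> L) = UNIV" by blast
  define E where "E = (\<lambda>P. ev3 C2 P q q1 q2)"
  have E: "is_hom E" unfolding E_def by (intro is_hom_ev3 is_hom_C2)
  note E_hom = hom_simps[OF E]
  have E_gens: "E (C3 c) = C2 c" "E Y0 = q" "E Y1 = q1" "E Y2 = q2" for c
    unfolding E_def Y0_def Y1_def Y2_def by (simp_all add: ev3_C3 ev3_y0 ev3_y1 ev3_y2)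
  have E_ev2: "E (ev2 C3 P u v) = ev2 C2 P (E u) (E v)" for P u v
    using hom_ev2[OF E is_hom_C3] by (simp only: E_gens)
  have E_ev3: "E (ev3 C3 P u v w) = ev3 C2 P (E u) (E v) (E w)" for P u v w
    using hom_ev3[OF E is_hom_C3] by (simp only: E_gens)
  have "E \<Lambda> = C2 (b ^ p) * q2 + ev2 C2 \<Gamma> q q1"
    unfolding \<Lambda> E_hom E_ev2 E_gens ..
  also have "\<dots> = 0"
    unfolding q2_eq q2_num_def ev2_\<Gamma>[OF is_hom_C2] by simp
  finally have E\<Lambda>: "E \<Lambda> = 0" .
  define l where "l = E L"
  have q: "q = ev2 C2 H 0 q1 + C2 (b ^ p) * l"
    using arg_cong[OF L(1), of E] unfolding E_hom E_ev2 E_gens E\<Lambda> l_def .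
  define \<psi> where "\<psi> = (\<lambda>P. ev2 C2 P q1 l)"
  have \<psi>: "is_hom \<psi>" unfolding \<psi>_def by (intro is_hom_ev2 is_hom_C2)
  note \<psi>_hom = hom_simps[OF \<psi>]
  have \<psi>_gens: "\<psi> (C2 c) = C2 c" "\<psi> X = q1" "\<psi> Y = l" for c
    unfolding \<psi>_def X_def Y_def by (simp_all add: ev2_C2 ev2_x ev2_y)
  have \<psi>_ev2: "\<psi> (ev2 C2 P u v) = ev2 C2 P (\<psi> u) (\<psi> v)" for P u v
    using hom_ev2[OF \<psi> is_hom_C2, of P u v] by (simp only: \<psi>_gens)
  have \<psi>_evC: "\<psi> (evC P u) = evC P (\<psi> u)" for P u
    using hom_eval[OF \<psi> is_hom_C2, of P u] by (simp only: \<psi>_gens)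
  have sub_range: "is_subring (range \<psi>)" by (rule is_subring_range[OF \<psi>])
  have C2_range: "C2 c \<in> range \<psi>" for c by (metis \<psi>_gens(1) rangeI)
  have "range \<psi> = B"
  proof (intro equalityI subsetI)
    fix u assume "u \<in> range \<psi>"
    moreover have "l \<in> B" unfolding l_def E_def B_def by blast
    ultimately show "u \<in> B"
      using subring_ev2[OF B_mem(1) is_hom_C2 B_mem(2,4)] unfolding \<psi>_def by blast
  next
    fix u assume "u \<in> B"
    then obtain P where "u = E P" unfolding B_def E_def by blast
    moreover obtain Q where "P = ev3 C3 Q Y1 \<Lambda> L" using L(2) by blast
    ultimately have "u = ev3 C2 Q q1 0 l" by (simp only: E_ev3 E_gens E\<Lambda> l_def)
    also have "\<dots> \<in> range \<psi>"
      using sub_range C2_range \<psi>_gens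
      by (intro subring_ev3 is_subring_0) (auto intro: range_eqI[OF sym])
    finally show "u \<in> range \<psi>" .
  qed
  moreover have "inj \<psi>"
  proof -
    \<comment> \<open>\<open>T1\<close> and \<open>T2\<close> are lifts of \<open>f\<close> and
      \<open>q\<close> along \<open>\<psi>\<close>. Up to powers of \<open>a\<close> each polynomial
      is a polynomial in them, so injectivity of \<open>\<psi>\<close> reduces to the independence
      of \<open>f\<close> and \<open>q\<close>.\<close>
    define T2 where "T2 = ev2 C2 H 0 X + C2 (b ^ p) * Y"
    define T1 where "T1 = C2 d * X + evC \<theta>s T2"
    have \<psi>T: "\<psi> T2 = q" "\<psi> T1 = f"
    proof -
      show "\<psi> T2 = q" unfolding T2_def \<psi>_hom \<psi>_ev2 \<psi>_gens by (rule q[symmetric])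
      then show "\<psi> T1 = f" unfolding T1_def \<psi>_hom \<psi>_evC \<psi>_gens by (simp add: q1_eq)
    qed
    define A where "A = range (\<lambda>P. ev2 C2 P T1 T2)"
    have A: "is_subring A" unfolding A_def by (intro is_subring_range is_hom_ev2 is_hom_C2)
    have C2A: "C2 c \<in> A" for c
      unfolding A_def by (rule range_eqI[of _ _ "C2 c"]) (simp add: ev2_C2)
    have "T1 = ev2 C2 [:0, 1:] T1 T2" "T2 = ev2 C2 [:[:0, 1:]:] T1 T2"
      by (simp_all add: ev2_x ev2_y)
    then have TA: "T1 \<in> A" "T2 \<in> A" unfolding A_def by (metis rangeI)+
    define S where "S = sat (C2 a) A"
    have S: "is_subring S" unfolding S_def by (intro is_subring_sat A C2A)
    have A_S: "A \<subseteq> S" unfolding S_def by (rule sat_superset)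
    have "C2 a ^ 1 * X = C2 b * (T1 - evC \<theta>s T2)" by (simp add: T1_def C2_a)
    also have "\<dots> \<in> S"
      using A_S subring_eval[OF A is_hom_C2 C2A TA(2)] A C2A TA
      by (blast intro: subring_intros)
    finally have X: "X \<in> S" unfolding S_def by (rule sat_cancel)
    have "C2 a ^ p * Y = C2 (d ^ p) * (T2 - ev2 C2 H 0 X)"
      by (simp add: T2_def C2_a C2_hom power_mult_distrib)
    also have "\<dots> \<in> S"
      using S A_S C2A TA X by (intro subring_intros subring_ev2) auto
    finally have Y: "Y \<in> S" unfolding S_def by (rule sat_cancel)
    have "P = 0" if "\<psi> P = 0" for P
    proof -
      have "P = ev2 C2 P X Y" by (simp add: X_def Y_def ev2_C2_id)
      also have "\<dots> \<in> S" using S A_S C2A X Y by (intro subring_ev2) auto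
      finally obtain n Q where nQ: "C2 a ^ n * P = ev2 C2 Q T1 T2"
        unfolding S_def sat_def A_def by blast
      have "ev2 C2 Q f q = \<psi> (C2 a ^ n * P)"
        unfolding nQ \<psi>_ev2 \<psi>T ..
      also have "\<dots> = 0" using that by (simp add: \<psi>_hom)
      finally have "Q = 0" by (rule fq_independent)
      then have "C2 a ^ n * P = 0" unfolding nQ by (simp add: ev2_hom)
      then show ?thesis using C2_nz by simp
    qed
    then have "u = v" if "\<psi> u = \<psi> v" for u v
      using that \<psi>_hom(6)[of u v] by (metis eq_iff_diff_eq_0)
    then show ?thesis by (rule injI)
  qed
  ultimately have "bij_betw \<psi> UNIV {u. \<phi> u = u}"
    by (simp add: bij_betw_def fixed_eq_B)
  moreover have "ralg_hom \<psi>"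
    unfolding ralg_hom_def by (simp add: \<psi>_hom \<psi>_gens)
  ultimately show "\<exists>\<psi>. ralg_hom \<psi> \<and> bij_betw \<psi> UNIV {u. \<phi> u = u}" by blast
qed

end

section \<open>Frobenius on polynomials, and the reduction to the comaximal case\<close>

lemma coeff_pcompose_monom:
  assumes "p > 0"
  shows "coeff (pcompose P (monom 1 p)) n = (if p dvd n then coeff P (n div p) else (0 :: 'a::comm_ring_1))"
proof (induction P arbitrary: n)
  case (pCons c P)
  show ?case
  proof (cases "n < p")
    case True
    then show ?thesis
      using assms by (cases n) (auto simp: pcompose_pCons coeff_monom_mult dest: dvd_imp_le)
  next
    case False
    then obtain m where n: "n = m + p" by (metis add.commute le_add_diff_inverse not_less)
    then show ?thesis
      using assms pCons
      by (auto simp: pcompose_pCons coeff_monom_mult coeff_pCons split: nat.splits)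
  qed
qed simp

lemma pcompose_frobenius:
  fixes P :: "'a::idom poly"
  assumes "CHAR('a) = p" "p > 0"
  shows "pcompose (map_poly (\<lambda>c. c ^ p) P) (monom 1 p) = P ^ p"
proof (induction P)
  case (pCons c P)
  have "prime p" using prime_CHAR_semidom[where 'a = 'a] assms by simp
  then have "([:c:] + [:0, 1:] * P) ^ p = [:c:] ^ p + ([:0, 1:] * P) ^ p"
    using assms by (intro freshmans_dream) simp_all
  moreover have "pCons c P = [:c:] + [:0, 1:] * P" by simp
  ultimately have "pCons c P ^ p = [:c ^ p:] + monom 1 p * P ^ p"
    unfolding power_mult_distrib by (simp only: poly_const_pow monom_altdef smult_1_left)
  then show ?case
    using pCons assms by (simp add: map_poly_pCons pcompose_pCons power_0_left)
qed (use assms in \<open>simp add: power_0_left\<close>)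

text \<open>Fermat's little theorem in the prime field; it makes the Frobenius twist of coefficients
  commute with differentiation.\<close>

lemma of_nat_power_CHAR:
  assumes "CHAR('a::idom) = p" "p > 0"
  shows "(of_nat n :: 'a) ^ p = of_nat n"
proof (induction n)
  case (Suc n)
  have "prime p" using prime_CHAR_semidom[where 'a = 'a] assms by simp
  then have "(1 + of_nat n :: 'a) ^ p = 1 ^ p + of_nat n ^ p"
    using assms by (intro freshmans_dream) simp_all
  then show ?case using Suc by simp
qed (use assms in \<open>simp add: power_0_left\<close>)

text \<open>A generator of the ideal divides the nonzero constant \<open>a\<close>, so it is a constant dividing
  the gcd \<open>d\<close>.\<close>

lemma gcd_in_principal_ideal:
  fixes a d :: "'a::idom" and D :: "'a poly"
  assumes a: "a \<noteq> 0" and gcd: "\<forall>c. c dvd [:a:] \<and> c dvd D \<longrightarrow> c dvd [:d:]"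
    and principal: "{C2 a * r + [:D:] * s | r s. True} = {g * t | t. True}"
  shows "\<exists>r s. [:d:] = [:a:] * r + D * s"
proof -
  let ?I = "{C2 a * r + [:D:] * s | r s. True}"
  have "C2 a * 1 + [:D:] * 0 \<in> ?I" "C2 a * 0 + [:D:] * 1 \<in> ?I" by blast+
  then have dvds: "g dvd C2 a" "g dvd [:D:]" unfolding principal by auto
  have "C2 a \<noteq> 0" using a by (simp add: C2_def)
  then have "degree g = 0" using dvd_imp_degree_le[OF dvds(1)] by (simp add: C2_def)
  then obtain g0 where g: "g = [:g0:]" by (rule degree_eq_zeroE)
  then have "g0 dvd [:d:]" using dvds by (intro gcd[rule_format]) (simp add: C2_def)
  then have "g dvd [:[:d:]:]" by (simp add: g)
  then have "[:[:d:]:] \<in> ?I" unfolding principal by (auto elim: dvdE)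
  then obtain r s where rs: "[:[:d:]:] = C2 a * r + [:D:] * s" by blast
  \<comment> \<open>Setting \<open>x = 0\<close> brings the relation from \<open>R[x,y]\<close> down
    to \<open>R[y]\<close>.\<close>
  have "[:d:] = [:a:] * poly r 0 + D * poly s 0"
    using arg_cong[OF rs, of "\<lambda>P. poly P 0"] by (simp add: C2_def)
  then show ?thesis by blast
qed

theorem theorem6p19:
  fixes p :: nat
    and a d :: "'a::{factorial_semiring, idom_divide}"
    and \<theta> :: "'a poly"
    and F :: "'a poly poly"
    and lam \<nu> :: "'a poly poly"
  defines "X \<equiv> [:0, 1:] :: 'a poly poly"
    and "Y \<equiv> [:[:0, 1:]:] :: 'a poly poly"
    and "Y0 \<equiv> [:0, 1:] :: 'a poly poly poly"
    and "Y1 \<equiv> [:[:0, 1:]:] :: 'a poly poly poly"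
    and "Y2 \<equiv> [:[:[:0, 1:]:]:] :: 'a poly poly poly"
  defines "f \<equiv> C2 a * X + poly (map_poly C2 \<theta>) Y"
    and "\<phi>x \<equiv> X + (poly (map_poly C2 \<theta>) Y - poly (map_poly C2 \<theta>) (Y + C2 a * F)) div C2 a"
    and "\<phi>y \<equiv> Y + C2 a * F"
  defines "\<phi> \<equiv> (\<lambda>u. ev2 C2 u \<phi>x \<phi>y)"
  defines "b \<equiv> a div d"
    and "\<rho> \<equiv> (\<Sum>i\<le>degree \<theta>. if p dvd i then 0 else monom (coeff \<theta> i div d) i)"
    and "\<rho>p \<equiv> (\<Sum>i\<le>degree \<theta>. if p dvd i then 0 else monom ((coeff \<theta> i div d) ^ p) i)"
    and "\<theta>s \<equiv> (\<Sum>i\<in>{1..degree \<theta>}. monom (coeff \<theta> (p * i)) i)"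
  defines "q \<equiv> Y ^ p - (C2 a * F) ^ (p - 1) * Y"
  defines "q1 \<equiv> (f - poly (map_poly C2 \<theta>s) q) div C2 d"
  defines "\<Lambda> \<equiv> C3 b ^ p * Y2 + poly (map_poly C3 \<rho>p) Y0 - Y1 ^ p
                 + C3 (b ^ (p - 1)) * ev2 C3 lam Y0 Y1 * ev2 C3 \<nu> Y0 Y1"
  assumes char: "CHAR('a) = p" and ppos: "p > 0"
    and a_nz: "a \<noteq> 0"
    and \<theta>_nz: "\<theta> \<noteq> 0" and \<theta>0: "coeff \<theta> 0 = 0"
    and F_in: "\<exists>G :: 'a poly. F = poly (map_poly C2 G) f" and F_nz: "F \<noteq> 0"
    and d_gcd: "[:d:] dvd [:a:]" "[:d:] dvd pderiv \<theta>"
               "\<forall>c :: 'a poly. c dvd [:a:] \<and> c dvd pderiv \<theta> \<longrightarrow> c dvd [:d:]"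
    and lam_def: "pderiv \<rho> ^ p * [:0, 1:] = ev2 (\<lambda>c. [:c:]) lam ([:0, 1:] ^ p) \<rho>"
    and \<nu>_def: "(C2 d * F) ^ (p - 1) = ev2 C2 \<nu> q q1"
    and principal: "\<exists>g :: 'a poly poly.
        {C2 a * r + [:pderiv \<theta>:] * s | r s. True} = {g * t | t. True}"
  shows "(\<exists>L :: 'a poly poly poly. range (\<lambda>P. ev3 C3 P Y1 \<Lambda> L) = UNIV)
         \<and> (\<exists>\<psi>. ralg_hom \<psi> \<and> bij_betw \<psi> UNIV {u. \<phi> u = u})"
proof -
  have da: "d dvd a" using d_gcd(1) by simp
  then have a_eq: "a = b * d" by (simp add: b_def)
  have d_nz: "d \<noteq> 0" using da a_nz by auto
  have coeff_\<rho>: "coeff \<rho> i = (if p dvd i then 0 else coeff \<theta> i div d)" for i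
    unfolding \<rho>_def coeff_sum
    by (subst sum.cong[OF refl, of _ _ "\<lambda>j. if j = i then if p dvd i then 0 else coeff \<theta> i div d else 0"])
      (auto simp: coeff_eq_0)
  have coeff_\<rho>p: "coeff \<rho>p i = coeff \<rho> i ^ p" for i
    unfolding \<rho>p_def coeff_sum coeff_\<rho> using ppos
    by (subst sum.cong[OF refl, of _ _ "\<lambda>j. if j = i then if p dvd i then 0 else (coeff \<theta> i div d) ^ p else 0"])
      (auto simp: coeff_eq_0 power_0_left)
  have coeff_\<theta>s: "coeff \<theta>s i = coeff \<theta> (p * i)" for i
  proof -
    have "coeff \<theta>s i = (\<Sum>j\<in>{1..degree \<theta>}. if j = i then coeff \<theta> (p * i) else 0)"
      unfolding \<theta>s_def coeff_sum by (intro sum.cong) auto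
    also have "\<dots> = coeff \<theta> (p * i)"
    proof (cases "i \<in> {1..degree \<theta>}")
      case False
      \<comment> \<open>Outside the summation range both sides vanish: at \<open>0\<close> by the
        zero constant term of \<open>\<theta>\<close>, and above the degree because
        \<open>p * i \<ge> i\<close>.\<close>
      then consider "i = 0" | "i > degree \<theta>" by fastforce
      then show ?thesis
      proof cases
        case 2
        moreover have "i \<le> p * i" using ppos by simp
        ultimately have "coeff \<theta> (p * i) = 0" by (intro coeff_eq_0) linarith
        then show ?thesis using 2 by simp
      qed (simp add: \<theta>0)
    qed simp
    finally show ?thesis .
  qed
  \<comment> \<open>\<open>d\<close> divides \<open>i\<close> times the coefficient, and
    \<open>i\<close> is invertible in \<open>R\<close>; this makes the divisions by \<open>d\<close>
    in \<open>\<rho>\<close> exact.\<close>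
  have d_dvd: "d dvd coeff \<theta> i" if np: "\<not> p dvd i" for i
  proof -
    have "i \<noteq> 0" using np by (rule contrapos_nn) simp
    then obtain j where j: "i = Suc j" using not0_implies_Suc by blast
    have "d dvd coeff (pderiv \<theta>) j"
      using d_gcd(2) by (simp only: const_poly_dvd_iff)
    then have "d dvd of_nat i * coeff \<theta> i"
      by (simp only: coeff_pderiv j)
    moreover obtain m where "of_nat m * of_nat i = (1 :: 'a)"
      using of_nat_invertible_mod_CHAR[OF char ppos np] by blast
    then have "coeff \<theta> i = of_nat m * (of_nat i * coeff \<theta> i)"
      by (simp flip: mult.assoc)
    ultimately show ?thesis by (metis dvd_mult)
  qed
  have \<theta>_eq: "\<theta> = smult d \<rho> + pcompose \<theta>s (monom 1 p)"
    using d_dvd ppos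
    by (intro poly_eqI) (simp add: coeff_\<rho> coeff_\<theta>s coeff_pcompose_monom)
  have "of_nat i * coeff \<theta> i = d * (of_nat i * coeff \<rho> i)" for i
  proof (cases "p dvd i")
    case True
    then have "of_nat i = (0 :: 'a)" using char by (simp add: of_nat_eq_0_iff_char_dvd)
    then show ?thesis by simp
  qed (use d_dvd in \<open>simp add: coeff_\<rho>\<close>)
  then have pderiv_\<theta>: "pderiv \<theta> = [:d:] * pderiv \<rho>"
    by (intro poly_eqI) (simp add: coeff_pderiv del: of_nat_Suc)
  obtain g where g: "{C2 a * r + [:pderiv \<theta>:] * s | r s. True} = {g * t | t. True}"
    using principal by (elim exE)
  obtain r s where rs: "[:d:] = [:a:] * r + pderiv \<theta> * s"
    using gcd_in_principal_ideal[OF a_nz d_gcd(3) g] by (elim exE)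
  \<comment> \<open>Both \<open>a\<close> and \<open>\<theta>'\<close> are multiples of
    \<open>d\<close>, so cancelling \<open>d\<close> in \<open>d = a r + \<theta>' s\<close> gives
    comaximality of \<open>b\<close> and \<open>\<rho>'\<close>.\<close>
  have "[:a:] * r + pderiv \<theta> * s = [:d:] * ([:b:] * r + pderiv \<rho> * s)"
    unfolding pderiv_\<theta> by (simp add: a_eq algebra_simps)
  then have "[:d:] * 1 = [:d:] * ([:b:] * r + pderiv \<rho> * s)"
    using rs by (simp only: mult_1_right)
  then have comaximal: "[:b:] * r + pderiv \<rho> * s = 1"
    using d_nz by (simp only: mult_cancel_left) simp
  have \<rho>p: "\<rho>p = map_poly (\<lambda>c. c ^ p) \<rho>"
    using ppos by (intro poly_eqI) (simp add: coeff_map_poly power_0_left coeff_\<rho>p)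
  have pderiv_\<rho>p: "pderiv \<rho>p = map_poly (\<lambda>c. c ^ p) (pderiv \<rho>)"
    using ppos by (intro poly_eqI)
      (simp add: coeff_map_poly power_0_left coeff_pderiv coeff_\<rho>p power_mult_distrib
        of_nat_power_CHAR[OF char] del: of_nat_Suc)
  obtain G where G: "F = poly (map_poly C2 G) f" using F_in by blast
  note defs = X_def Y_def f_def q_def q1_def \<phi>x_def \<phi>_def[unfolded \<phi>y_def]
  interpret comaximal_case p a b d \<theta> \<rho> \<theta>s G X Y f F q q1 \<phi>x \<phi> \<rho>p r s lam \<nu>
  proof
    show "pcompose \<rho>p (monom 1 p) = \<rho> ^ p"
      unfolding \<rho>p by (rule pcompose_frobenius[OF char ppos])
    show "pcompose (pderiv \<rho>p) (monom 1 p) = pderiv \<rho> ^ p"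
      unfolding pderiv_\<rho>p by (rule pcompose_frobenius[OF char ppos])
    show "coeff \<rho> i = 0" if "p dvd i" for i using that by (simp add: coeff_\<rho>)
  qed (rule char ppos a_eq a_nz \<theta>_eq G F_nz coeff_\<rho>p lam_def \<nu>_def comaximal
      defs[THEN meta_eq_to_obj_eq])+
  show ?thesis
    using coordinate_and_fixed_ring unfolding \<Lambda>_def Y0_def Y1_def Y2_def by blast
qed

end
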